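(* Let $F(L)\in\mathbb{H}^\infty_d\otimes\mathcal{L}(\mathcal{F},\mathcal{J})$ and $G(L)\in\mathbb{H}^\infty_d\otimes\mathcal{L}(\mathcal{G},\mathcal{J})$ be operator-valued left NC multipliers with the same coefficient range space $\mathcal{J}$, and let $\mathscr{M}:=\mathscr{M}^L(F)\wedge\mathscr{M}^L(G)$. Then there is an operator-valued left multiplier $H(L)\in\mathbb{H}^\infty_d\otimes\mathcal{L}(\mathcal{H},\mathcal{J})$ with $\dim(\mathcal{H})\le\dim(\mathcal{F})+\dim(\mathcal{G})$ such that $\mathscr{M}=\mathscr{M}^L(H)$, $$\mathrm{Ran}(H(L))=\mathrm{Ran}(F(L))\cap\mathrm{Ran}(G(L)),$$ and $\|H(L)\|\le\max\{\|F(L)\|,\|G(L)\|\}$.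
   Context: Let $d\in\mathbb{N}$. The NC Hardy space (full Fock space) $\mathbb{H}^2_d$ is the Hilbert space of formal power series in $d$ non-commuting variables $\mathfrak{z}_1,\dots,\mathfrak{z}_d$ with square-summable coefficients. $R_k$ is the isometry of right multiplication by $\mathfrak{z}_k$. For Hilbert spaces $\mathcal{F},\mathcal{J}$, $\mathbb{H}^\infty_d\otimes\mathcal{L}(\mathcal{F},\mathcal{J})$ is the space of operator-valued left multipliers: equivalently the bounded operators $F=F(L):\mathbb{H}^2_d\otimes\mathcal{F}\to\mathbb{H}^2_d\otimes\mathcal{J}$ with $F(L)(R_k\otimes I_{\mathcal{F}})=(R_k\otimes I_{\mathcal{J}})F(L)$ for all $k$. $\mathscr{M}^L(F)$ is the space $\mathrm{Ran}(F(L))$ with norm $\|F(L)x\|_F:=\|P_{\mathrm{Ker}(F(L))^\perp}x\|$. $\mathscr{M}^L(F)\wedge\mathscr{M}^L(G)$ is the Hilbert space $\mathscr{M}^L(F)\cap\mathscr{M}^L(G)$ with norm $\|h\|^2=\|h\|_F^2+\|h\|_G^2$. Equality $\mathscr{M}=\mathscr{M}^L(H)$ is equality of Hilbert spaces (same vectors, same norm). *)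

theory Defs
  imports "HOL-Analysis.Analysis"
begin

unbundle cardinal_syntax

section \<open>Complex Hilbert spaces\<close>

text \<open>The inner product is conjugate-linear in its first argument.\<close>

class chilbert_space = real_inner + complete_space +
  fixes scaleC :: "complex \<Rightarrow> 'a \<Rightarrow> 'a"  (infixr \<open>*\<^sub>C\<close> 75)
    and cinner :: "'a \<Rightarrow> 'a \<Rightarrow> complex"
  assumes scaleC_add_right: "c *\<^sub>C (x + y) = c *\<^sub>C x + c *\<^sub>C y"
    and scaleC_add_left: "(c + d) *\<^sub>C x = c *\<^sub>C x + d *\<^sub>C x"
    and scaleC_scaleC: "c *\<^sub>C d *\<^sub>C x = (c * d) *\<^sub>C x"
    and scaleC_of_real: "of_real r *\<^sub>C x = r *\<^sub>R x"
    and cinner_commute: "cinner x y = cnj (cinner y x)"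
    and cinner_add_right: "cinner x (y + z) = cinner x y + cinner x z"
    and cinner_scaleC_right: "cinner x (c *\<^sub>C y) = c * cinner x y"
    and Re_cinner: "Re (cinner x y) = inner x y"

lemma cinner_add_left: "cinner (x + y) (z::'a::chilbert_space) = cinner x z + cinner y z"
  by (metis cinner_add_right cinner_commute complex_cnj_add)

lemma cinner_scaleC_left: "cinner (c *\<^sub>C x) (y::'a::chilbert_space) = cnj c * cinner x y"
  by (metis cinner_scaleC_right cinner_commute complex_cnj_mult)

lemma cinner_self: "cinner x x = of_real ((norm (x::'a::chilbert_space))\<^sup>2)"
proof (rule complex_eqI)
  show "Re (cinner x x) = Re (of_real ((norm x)\<^sup>2))"
    by (simp add: Re_cinner power2_norm_eq_inner)
  have "Im (cinner x x) = - Im (cinner x x)"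
    by (metis cinner_commute complex_cnj_cnj cnj.sel(2))
  then show "Im (cinner x x) = Im (of_real ((norm x)\<^sup>2))" by simp
qed

lemma norm_scaleC: "norm (c *\<^sub>C (x::'a::chilbert_space)) = cmod c * norm x"
proof -
  have "complex_of_real ((norm (c *\<^sub>C x))\<^sup>2) = of_real ((cmod c * norm x)\<^sup>2)"
    unfolding cinner_self[symmetric] cinner_scaleC_left cinner_scaleC_right
    by (simp add: cinner_self power_mult_distrib complex_norm_square mult_ac del: of_real_power)
  then have "(norm (c *\<^sub>C x))\<^sup>2 = (cmod c * norm x)\<^sup>2" by (simp only: of_real_eq_iff)
  then show ?thesis by (simp add: power2_eq_iff_nonneg)
qed

lemma scaleC_zero_right [simp]: "c *\<^sub>C (0::'a::chilbert_space) = 0"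
  using norm_scaleC[of c "0::'a"] by simp

lemma scaleC_minus_one: "(-1) *\<^sub>C (x::'a::chilbert_space) = - x"
  using scaleC_of_real[of "-1" x] by simp

lemma cinner_minus_right: "cinner x (- (y::'a::chilbert_space)) = - cinner x y"
  using cinner_scaleC_right[of x "-1" y] by (simp add: scaleC_minus_one)

lemma cinner_diff_right: "cinner x (y - (z::'a::chilbert_space)) = cinner x y - cinner x z"
  using cinner_add_right[of x y "-z"] by (simp add: cinner_minus_right)

lemma norm_cinner_le: "cmod (cinner x (y::'a::chilbert_space)) \<le> norm x * norm y"
proof (cases "cinner x y = 0")
  case False
  define c where "c = cnj (cinner x y) / of_real (cmod (cinner x y))"
  have c: "cmod c = 1" using False by (simp add: c_def norm_divide)
  have "c * cinner x y = of_real (cmod (cinner x y))"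
    using False complex_norm_square[of "cinner x y"]
    by (simp add: c_def mult.commute[of "cnj _"] power2_eq_square nonzero_divide_eq_eq)
  then have "cmod (cinner x y) = Re (cinner x (c *\<^sub>C y))"
    by (simp add: cinner_scaleC_right)
  also have "\<dots> \<le> norm x * norm (c *\<^sub>C y)"
    unfolding Re_cinner by (rule norm_cauchy_schwarz)
  finally show ?thesis by (simp add: norm_scaleC c)
qed simp

instantiation complex :: chilbert_space
begin
definition scaleC_complex :: "complex \<Rightarrow> complex \<Rightarrow> complex"
  where "scaleC_complex c x = c * x"
definition cinner_complex :: "complex \<Rightarrow> complex \<Rightarrow> complex"
  where "cinner_complex x y = cnj x * y"
instance
  by intro_classes
    (auto simp: scaleC_complex_def cinner_complex_def algebra_simps scaleR_conv_of_real
      inner_complex_def)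
end

instantiation prod :: (chilbert_space, chilbert_space) chilbert_space
begin
definition scaleC_prod :: "complex \<Rightarrow> 'a \<times> 'b \<Rightarrow> 'a \<times> 'b"
  where "scaleC_prod c x = (c *\<^sub>C fst x, c *\<^sub>C snd x)"
definition cinner_prod :: "'a \<times> 'b \<Rightarrow> 'a \<times> 'b \<Rightarrow> complex"
  where "cinner_prod x y = cinner (fst x) (fst y) + cinner (snd x) (snd y)"
instance
proof
  fix x y :: "'a \<times> 'b"
  show "cinner x y = cnj (cinner y x)"
    unfolding cinner_prod_def by (metis cinner_commute complex_cnj_add)
qed (auto simp: scaleC_prod_def cinner_prod_def scaleC_add_right scaleC_add_left scaleC_scaleC
      scaleC_of_real cinner_add_right cinner_scaleC_right Re_cinner inner_prod_def
      algebra_simps prod_eq_iff)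
end

text \<open>
  A Hilbert space is given as a closed subspace of a type of class \<open>chilbert_space\<close>
  (possibly the whole type), so that it is possible to quantify over Hilbert spaces inside a
  formula.
\<close>

definition closed_csubspace :: "'a::chilbert_space set \<Rightarrow> bool" where
  "closed_csubspace S \<longleftrightarrow> closed S \<and> 0 \<in> S \<and> (\<forall>x\<in>S. \<forall>y\<in>S. x + y \<in> S) \<and> (\<forall>c. \<forall>x\<in>S. c *\<^sub>C x \<in> S)"

definition bounded_clinear_on :: "'a::chilbert_space set \<Rightarrow> ('a \<Rightarrow> 'b::chilbert_space) \<Rightarrow> bool" where
  "bounded_clinear_on S T \<longleftrightarrow>
     (\<forall>x\<in>S. \<forall>y\<in>S. T (x + y) = T x + T y) \<and> (\<forall>c. \<forall>x\<in>S. T (c *\<^sub>C x) = c *\<^sub>C T x) \<and>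
     (\<exists>K. \<forall>x\<in>S. norm (T x) \<le> K * norm x)"

definition op_norm :: "'a::chilbert_space set \<Rightarrow> ('a \<Rightarrow> 'b::chilbert_space) \<Rightarrow> real" where
  "op_norm S T = (SUP x\<in>{x\<in>S. norm x \<le> 1}. norm (T x))"

definition ker_on :: "'a::chilbert_space set \<Rightarrow> ('a \<Rightarrow> 'b::chilbert_space) \<Rightarrow> 'a set" where
  "ker_on S T = {x\<in>S. T x = 0}"

definition orth_compl :: "'a::chilbert_space set \<Rightarrow> 'a set \<Rightarrow> 'a set" where
  "orth_compl S M = {x\<in>S. \<forall>m\<in>M. cinner m x = 0}"

definition orth_proj :: "'a::chilbert_space set \<Rightarrow> 'a \<Rightarrow> 'a" where
  "orth_proj M x = (THE p. p \<in> M \<and> (\<forall>m\<in>M. cinner m (x - p) = 0))"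

lemma orth_proj_exists1:
  fixes M :: "'a::chilbert_space set"
  assumes "closed_csubspace M"
  shows "\<exists>!p. p \<in> M \<and> (\<forall>m\<in>M. cinner m (x - p) = 0)"
proof (rule ex_ex1I)
  have cl: "closed M" and zero: "0 \<in> M" and add: "\<And>a b. a \<in> M \<Longrightarrow> b \<in> M \<Longrightarrow> a + b \<in> M"
    and sc: "\<And>c a. a \<in> M \<Longrightarrow> c *\<^sub>C a \<in> M"
    using assms by (auto simp: closed_csubspace_def)
  have scR: "r *\<^sub>R a \<in> M" if "a \<in> M" for r a
    using sc[OF that, of "of_real r"] by (simp add: scaleC_of_real)
  define \<delta> where "\<delta> = (INF m\<in>M. (norm (x - m))\<^sup>2)"
  have bdd: "bdd_below ((\<lambda>m. (norm (x - m))\<^sup>2) ` M)"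
    by (rule bdd_belowI2[where m = 0]) simp
  have lower: "\<delta> \<le> (norm (x - m))\<^sup>2" if "m \<in> M" for m
    unfolding \<delta>_def by (rule cINF_lower[OF bdd that])
  have "\<exists>m\<in>M. (norm (x - m))\<^sup>2 < \<delta> + inverse (of_nat (Suc n))" for n
    using cINF_less_iff[OF _ bdd, of "\<delta> + inverse (of_nat (Suc n))"] zero
    unfolding \<delta>_def[symmetric] by auto
  then obtain m where mM: "\<And>n. m n \<in> M"
    and m: "\<And>n. (norm (x - m n))\<^sup>2 < \<delta> + inverse (of_nat (Suc n))" by metis
  have close: "(norm (m i - m j))\<^sup>2 \<le> 2 * inverse (of_nat (Suc i)) + 2 * inverse (of_nat (Suc j))" for i j
  proof -
    have "(1/2) *\<^sub>R (m i + m j) \<in> M" by (intro scR add mM)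
    then have "\<delta> \<le> (norm (x - (1/2) *\<^sub>R (m i + m j)))\<^sup>2" by (rule lower)
    moreover have "(norm (m i - m j))\<^sup>2 = 2 * (norm (x - m i))\<^sup>2 + 2 * (norm (x - m j))\<^sup>2
        - 4 * (norm (x - (1/2) *\<^sub>R (m i + m j)))\<^sup>2"
      by (simp add: power2_norm_eq_inner inner_diff_left inner_diff_right inner_add_left
          inner_add_right inner_commute algebra_simps)
    ultimately show ?thesis using m[of i] m[of j] by linarith
  qed
  have "Cauchy m"
  proof (rule CauchyI)
    fix e :: real assume e: "e > 0"
    then obtain N where N: "inverse (of_nat (Suc N)) < e\<^sup>2 / 4"
      using reals_Archimedean[of "e\<^sup>2 / 4"] by auto
    have "norm (m i - m j) < e" if "i \<ge> N" "j \<ge> N" for i j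
    proof -
      have "inverse (of_nat (Suc i) :: real) \<le> inverse (of_nat (Suc N))"
        "inverse (of_nat (Suc j) :: real) \<le> inverse (of_nat (Suc N))"
        using that by (auto simp: le_imp_inverse_le)
      then have "(norm (m i - m j))\<^sup>2 < e\<^sup>2" using close[of i j] N by linarith
      then show ?thesis using e by (simp add: power2_less_imp_less)
    qed
    then show "\<exists>N. \<forall>i\<ge>N. \<forall>j\<ge>N. norm (m i - m j) < e" by blast
  qed
  then obtain p where p: "m \<longlonglongrightarrow> p" by (auto simp: Cauchy_convergent_iff convergent_def)
  have pM: "p \<in> M" using cl p mM closed_sequentially by blast
  have "(norm (x - p))\<^sup>2 \<le> \<delta>"
  proof (rule LIMSEQ_le)
    show "(\<lambda>n. (norm (x - m n))\<^sup>2) \<longlonglongrightarrow> (norm (x - p))\<^sup>2" by (intro tendsto_intros p)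
    have "(\<lambda>n. \<delta> + inverse (of_nat (Suc n))) \<longlonglongrightarrow> \<delta> + 0"
      by (intro tendsto_intros LIMSEQ_inverse_real_of_nat)
    then show "(\<lambda>n. \<delta> + inverse (of_nat (Suc n))) \<longlonglongrightarrow> \<delta>" by simp
    show "\<exists>N. \<forall>n\<ge>N. (norm (x - m n))\<^sup>2 \<le> \<delta> + inverse (of_nat (Suc n))"
      using m less_imp_le by blast
  qed
  then have min: "(norm (x - p))\<^sup>2 \<le> (norm (x - a))\<^sup>2" if "a \<in> M" for a
    using lower[OF that] by linarith
  have re: "inner a (x - p) = 0" if a: "a \<in> M" for a
  proof (rule ccontr)
    define t where "t = inner a (x - p) / inner a a"
    assume n: "inner a (x - p) \<noteq> 0"
    then have "a \<noteq> 0" by auto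
    then have pos: "inner a a > 0" by simp
    have "(norm (x - p))\<^sup>2 \<le> (norm (x - (p + t *\<^sub>R a)))\<^sup>2"
      by (intro min add pM scR a)
    also have "x - (p + t *\<^sub>R a) = (x - p) - t *\<^sub>R a" by simp
    also have "(norm ((x - p) - t *\<^sub>R a))\<^sup>2
        = (norm (x - p))\<^sup>2 - 2 * t * inner a (x - p) + t * t * inner a a"
      by (simp only: power2_norm_eq_inner inner_diff_left[of _ _ "_ - _ *\<^sub>R _"]
          inner_diff_right[of _ "_ - _" "_ *\<^sub>R _"] inner_scaleR_left inner_scaleR_right
          inner_diff_right[of _ "x - p" "t *\<^sub>R a"] inner_diff_left[of "x - p" "t *\<^sub>R a"]
          inner_commute[of "x - p" a]) (simp add: algebra_simps)
    also have "\<dots> = (norm (x - p))\<^sup>2 - t * inner a (x - p)"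
      using pos by (simp add: t_def)
    finally have "t * inner a (x - p) \<le> 0" by simp
    moreover have "t * inner a (x - p) > 0"
      using n pos by (simp add: t_def not_sum_power2_lt_zero flip: power2_eq_square)
    ultimately show False by simp
  qed
  have "cinner a (x - p) = 0" if a: "a \<in> M" for a
  proof (rule complex_eqI)
    show "Re (cinner a (x - p)) = Re 0" using re[OF a] by (simp add: Re_cinner)
    have "Re (cinner (\<i> *\<^sub>C a) (x - p)) = 0" using re[OF sc[OF a]] by (simp add: Re_cinner)
    then show "Im (cinner a (x - p)) = Im 0" by (simp add: cinner_scaleC_left)
  qed
  with pM show "\<exists>p. p \<in> M \<and> (\<forall>m\<in>M. cinner m (x - p) = 0)" by blast
next
  fix p q
  assume p: "p \<in> M \<and> (\<forall>m\<in>M. cinner m (x - p) = 0)"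
    and q: "q \<in> M \<and> (\<forall>m\<in>M. cinner m (x - q) = 0)"
  have eq: "(x - q) - (x - p) = p - q" by simp
  have "p + (-1) *\<^sub>C q \<in> M" using assms p q unfolding closed_csubspace_def by blast
  then have "p - q \<in> M" by (simp add: scaleC_minus_one)
  then have "cinner (p - q) ((x - q) - (x - p)) = 0"
    unfolding cinner_diff_right[of _ "x - q" "x - p"] using p q by simp
  then show "p = q" unfolding eq by (simp add: cinner_self)
qed

lemma closed_csubspace_orth_compl:
  assumes "closed_csubspace S"
  shows "closed_csubspace (orth_compl S (M :: 'a::chilbert_space set))"
proof -
  have cont: "continuous_on UNIV (cinner m)" for m :: 'a
  proof (rule continuous_on_iff[THEN iffD2], intro ballI allI impI)
    fix x :: 'a and e :: real
    assume e: "e > 0"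
    have "dist (cinner m y) (cinner m x) < e" if y: "dist y x < e / (norm m + 1)" for y
    proof -
      have "dist (cinner m y) (cinner m x) \<le> norm m * dist y x"
        using norm_cinner_le[of m "y - x"] by (simp add: dist_norm cinner_diff_right)
      also have "\<dots> \<le> (norm m + 1) * dist y x" by (intro mult_right_mono) auto
      also have "\<dots> < e"
        using y by (simp add: pos_less_divide_eq add_nonneg_pos mult.commute)
      finally show ?thesis .
    qed
    then show "\<exists>d>0. \<forall>y\<in>UNIV. dist y x < d \<longrightarrow> dist (cinner m y) (cinner m x) < e"
      using e by (intro exI[of _ "e / (norm m + 1)"]) (auto simp: add_nonneg_pos)
  qed
  have "closed {x. cinner m x = 0}" for m :: 'a
    by (rule closed_Collect_eq[OF cont]) simp
  then have "closed (S \<inter> (\<Inter>m\<in>M. {x. cinner m x = 0}))"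
    using assms by (intro closed_Int closed_INT) (auto simp: closed_csubspace_def)
  moreover have "orth_compl S M = S \<inter> (\<Inter>m\<in>M. {x. cinner m x = 0})"
    by (auto simp: orth_compl_def)
  moreover have "cinner m 0 = 0" for m :: 'a using cinner_diff_right[of m 0 0] by simp
  ultimately show ?thesis
    using assms unfolding closed_csubspace_def
    by (auto simp: orth_compl_def cinner_add_right cinner_scaleC_right)
qed

text \<open>An orthonormal basis is a maximal orthonormal set.\<close>

definition is_onb :: "'a::chilbert_space set \<Rightarrow> 'a set \<Rightarrow> bool" where
  "is_onb S B \<longleftrightarrow> B \<subseteq> S \<and> (\<forall>x\<in>B. \<forall>y\<in>B. cinner x y = (if x = y then 1 else 0)) \<and>
     (\<forall>x\<in>S. (\<forall>b\<in>B. cinner b x = 0) \<longrightarrow> x = 0)"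

definition hilbert_dim :: "'a::chilbert_space set \<Rightarrow> 'a rel" where
  "hilbert_dim S = |SOME B. is_onb S B|"

lemma onb_exists:
  assumes "closed_csubspace S"
  shows "\<exists>B. is_onb S (B :: 'a::chilbert_space set)"
proof -
  define A where "A = {B. B \<subseteq> S \<and> (\<forall>x\<in>B. \<forall>y\<in>B. cinner x y = (if x = y then 1 else 0))}"
  have "\<Union>C \<in> A" if C: "subset.chain A C" for C
  proof -
    have sub: "C \<subseteq> A" using C by (auto simp: subset.chain_def)
    have "cinner x y = (if x = y then 1 else 0)" if "X \<in> C" "Y \<in> C" "x \<in> X" "y \<in> Y" for X Y x y
    proof -
      have "X \<subseteq> Y \<or> Y \<subseteq> X" using C that by (auto simp: subset_chain_def)
      then have "\<exists>Z\<in>C. x \<in> Z \<and> y \<in> Z" using that by blast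
      then show ?thesis using sub unfolding A_def by blast
    qed
    moreover have "\<Union>C \<subseteq> S" using sub by (auto simp: A_def)
    ultimately show ?thesis unfolding A_def by blast
  qed
  moreover have "{} \<in> A" by (simp add: A_def)
  ultimately obtain B where B: "B \<in> A" and max: "\<And>X. X \<in> A \<Longrightarrow> B \<subseteq> X \<Longrightarrow> X = B"
    using subset_Zorn'[of A] by metis
  have "x = 0" if x: "x \<in> S" and orth: "\<forall>b\<in>B. cinner b x = 0" for x
  proof (rule ccontr)
    assume nz: "x \<noteq> 0"
    define u where "u = of_real (inverse (norm x)) *\<^sub>C x"
    have bu: "cinner b u = 0" if "b \<in> B" for b
      using orth that by (simp add: u_def cinner_scaleC_right)
    have ub: "cinner u b = 0" if "b \<in> B" for b
      using cinner_commute[of u b] bu[OF that] by simp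
    have uu: "cinner u u = 1"
      using nz by (simp add: cinner_self u_def norm_scaleC norm_inverse del: of_real_inverse)
    have uB: "u \<notin> B" using bu uu by force
    have "u \<in> S" using x assms by (simp add: u_def closed_csubspace_def)
    then have "insert u B \<subseteq> S" using B by (simp add: A_def)
    moreover have "cinner a b = (if a = b then 1 else 0)" if "a \<in> B" "b \<in> B" for a b
      using B that unfolding A_def by blast
    then have "cinner a b = (if a = b then 1 else 0)" if "a \<in> insert u B" "b \<in> insert u B" for a b
      using that bu[of a] ub[of b] uu uB by (cases "a = u"; cases "b = u") simp_all
    ultimately have "insert u B \<in> A" unfolding A_def by blast
    then show False using max uB by blast
  qed
  then have "is_onb S B" using B unfolding is_onb_def A_def by blast
  then show ?thesis ..
qed

text \<open>
  The range of an operator on \<open>S\<close> (first component) with the norm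
  \<open>\<parallel>T x\<parallel>\<^sub>T = \<parallel>P x\<parallel>\<close> (second component), where \<open>P\<close> is the projection onto the orthogonal
  complement of the kernel. The norm functions below are restricted to the underlying set of vectors,
  so equality of such pairs means same vectors and same norm.
\<close>

definition range_space :: "'a::chilbert_space set \<Rightarrow> ('a \<Rightarrow> 'b::chilbert_space) \<Rightarrow> 'b set \<times> ('b \<Rightarrow> real)" where
  "range_space S T = (T ` S, \<lambda>h\<in>T ` S.
     THE r. \<exists>x\<in>S. T x = h \<and> r = norm (orth_proj (orth_compl S (ker_on S T)) x))"

lemma range_space_norm:
  assumes S: "closed_csubspace S" and T: "bounded_clinear_on S T" and x: "x \<in> S"
  shows "snd (range_space S T) (T x) = norm (orth_proj (orth_compl S (ker_on S T)) x)"
proof -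
  define M where "M = orth_compl S (ker_on S T)"
  have M: "closed_csubspace M" unfolding M_def by (rule closed_csubspace_orth_compl[OF S])
  have eq: "orth_proj M y = orth_proj M x" if y: "y \<in> S" "T y = T x" for y
  proof -
    have "x + (-1) *\<^sub>C y \<in> S" using S x y unfolding closed_csubspace_def by blast
    moreover have "T (x + (-1) *\<^sub>C y) = T x + (-1) *\<^sub>C T y"
      using T S x y unfolding bounded_clinear_on_def closed_csubspace_def by metis
    then have "T (x + (-1) *\<^sub>C y) = 0" by (simp add: scaleC_minus_one y)
    ultimately have "x + (-1) *\<^sub>C y \<in> ker_on S T" by (simp add: ker_on_def)
    then have "x - y \<in> ker_on S T" by (simp add: scaleC_minus_one)
    then have z: "cinner m (x - y) = 0" if "m \<in> M" for m
      using that cinner_commute[of m "x - y"] by (auto simp: M_def orth_compl_def)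
    have "cinner m (y - p) = 0 \<longleftrightarrow> cinner m (x - p) = 0" if "m \<in> M" for m p
      using z[OF that] by (simp add: cinner_diff_right)
    then show ?thesis by (simp add: orth_proj_def cong: conj_cong)
  qed
  have "(THE r. \<exists>y\<in>S. T y = T x \<and> r = norm (orth_proj M y)) = norm (orth_proj M x)"
  proof (rule the_equality)
    show "\<exists>y\<in>S. T y = T x \<and> norm (orth_proj M x) = norm (orth_proj M y)" using x by blast
  qed (use eq in metis)
  then show ?thesis using x by (simp add: range_space_def M_def)
qed

definition wedge :: "'b set \<times> ('b \<Rightarrow> real) \<Rightarrow> 'b set \<times> ('b \<Rightarrow> real) \<Rightarrow> 'b set \<times> ('b \<Rightarrow> real)" where
  "wedge M N = (fst M \<inter> fst N, \<lambda>h\<in>fst M \<inter> fst N. sqrt ((snd M h)\<^sup>2 + (snd N h)\<^sup>2))"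


section \<open>The NC Hardy space with Hilbert space coefficients\<close>

text \<open>
  The word \<open>[i1, \<dots>, in]\<close> stands for the monomial \<open>z_i1 \<cdots> z_in\<close>. The Hilbert space tensor
  product of the NC Hardy space with a Hilbert space is the space of power series with
  square-summable coefficients in that space; see the facts on \<open>tensor\<close> below. The scalar
  NC Hardy space is \<open>('d, complex) hardy\<close>.
\<close>

typedef (overloaded) ('d, 'a::chilbert_space) hardy =
  "{f :: 'd list \<Rightarrow> 'a. (\<lambda>w. (norm (f w))\<^sup>2) summable_on UNIV}"
  morphisms hcoeff Hardy
  by (rule exI[of _ "\<lambda>_. 0"]) simp

lemma hcoeff_summable: "(\<lambda>w. (norm (hcoeff f w))\<^sup>2) summable_on UNIV"
  using hcoeff[of f] by simp

lemma hcoeff_Hardy: "(\<lambda>w. (norm (f w))\<^sup>2) summable_on UNIV \<Longrightarrow> hcoeff (Hardy f) = f"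
  by (simp add: Hardy_inverse)

lemma hardy_eqI: "(\<And>w. hcoeff f w = hcoeff g w) \<Longrightarrow> f = g"
  by (metis hcoeff_inject ext)

lemma square_summable_add:
  fixes f g :: "'d \<Rightarrow> 'a::real_inner"
  assumes "(\<lambda>w. (norm (f w))\<^sup>2) summable_on UNIV" "(\<lambda>w. (norm (g w))\<^sup>2) summable_on UNIV"
  shows "(\<lambda>w. (norm (f w + g w))\<^sup>2) summable_on UNIV"
proof (rule summable_on_comparison_test)
  show "(\<lambda>w. 2 * ((norm (f w))\<^sup>2 + (norm (g w))\<^sup>2)) summable_on UNIV"
    by (intro summable_on_cmult_right summable_on_add assms)
  fix w
  have "(norm (f w + g w))\<^sup>2 \<le> (norm (f w) + norm (g w))\<^sup>2"
    by (intro power_mono norm_triangle_ineq) auto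
  also have "\<dots> \<le> 2 * ((norm (f w))\<^sup>2 + (norm (g w))\<^sup>2)"
    using sum_squares_bound[of "norm (f w)" "norm (g w)"]
    by (simp add: power2_eq_square algebra_simps)
  finally show "(norm (f w + g w))\<^sup>2 \<le> 2 * ((norm (f w))\<^sup>2 + (norm (g w))\<^sup>2)" .
qed auto

lemma square_summable_scaleC:
  fixes f :: "'d \<Rightarrow> 'a::chilbert_space"
  assumes "(\<lambda>w. (norm (f w))\<^sup>2) summable_on UNIV"
  shows "(\<lambda>w. (norm (c *\<^sub>C f w))\<^sup>2) summable_on UNIV"
  using summable_on_cmult_right[OF assms, of "(cmod c)\<^sup>2"]
  by (simp add: norm_scaleC power_mult_distrib)

instantiation hardy :: (type, chilbert_space) real_inner
begin

definition zero_hardy :: "('a, 'b) hardy" where "0 = Hardy (\<lambda>_. 0)"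
definition plus_hardy :: "('a, 'b) hardy \<Rightarrow> ('a, 'b) hardy \<Rightarrow> ('a, 'b) hardy"
  where "f + g = Hardy (\<lambda>w. hcoeff f w + hcoeff g w)"
definition scaleR_hardy :: "real \<Rightarrow> ('a, 'b) hardy \<Rightarrow> ('a, 'b) hardy"
  where "r *\<^sub>R f = Hardy (\<lambda>w. r *\<^sub>R hcoeff f w)"
definition uminus_hardy :: "('a, 'b) hardy \<Rightarrow> ('a, 'b) hardy"
  where "- f = Hardy (\<lambda>w. - hcoeff f w)"
definition minus_hardy :: "('a, 'b) hardy \<Rightarrow> ('a, 'b) hardy \<Rightarrow> ('a, 'b) hardy"
  where "f - g = f + - (g :: ('a, 'b) hardy)"
definition inner_hardy :: "('a, 'b) hardy \<Rightarrow> ('a, 'b) hardy \<Rightarrow> real"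
  where "inner f g = (\<Sum>\<^sub>\<infinity>w. inner (hcoeff f w) (hcoeff g w))"
definition norm_hardy :: "('a, 'b) hardy \<Rightarrow> real"
  where "norm f = sqrt (\<Sum>\<^sub>\<infinity>w. (norm (hcoeff f w))\<^sup>2)"
definition dist_hardy :: "('a, 'b) hardy \<Rightarrow> ('a, 'b) hardy \<Rightarrow> real"
  where "dist f g = norm (f - g :: ('a, 'b) hardy)"
definition sgn_hardy :: "('a, 'b) hardy \<Rightarrow> ('a, 'b) hardy"
  where "sgn f = inverse (norm f) *\<^sub>R (f :: ('a, 'b) hardy)"
definition uniformity_hardy :: "(('a, 'b) hardy \<times> ('a, 'b) hardy) filter"
  where "uniformity_hardy =
    (INF e\<in>{0<..}. principal {(x, y). dist (x :: ('a, 'b) hardy) y < e})"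
definition open_hardy :: "('a, 'b) hardy set \<Rightarrow> bool"
  where "open_hardy U \<longleftrightarrow>
    (\<forall>x\<in>U. \<forall>\<^sub>F (x', y) in uniformity. x' = (x :: ('a, 'b) hardy) \<longrightarrow> y \<in> U)"

lemma hcoeff_zero: "hcoeff (0 :: ('a, 'b) hardy) w = 0"
  by (simp add: zero_hardy_def hcoeff_Hardy)
lemma hcoeff_plus: "hcoeff (f + g :: ('a, 'b) hardy) w = hcoeff f w + hcoeff g w"
  by (simp add: plus_hardy_def hcoeff_Hardy square_summable_add hcoeff_summable)
lemma hcoeff_scaleR: "hcoeff (r *\<^sub>R f :: ('a, 'b) hardy) w = r *\<^sub>R hcoeff f w"
  using square_summable_scaleC[OF hcoeff_summable[of f], of "of_real r"]
  by (simp add: scaleR_hardy_def hcoeff_Hardy scaleC_of_real)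
lemma hcoeff_uminus: "hcoeff (- f :: ('a, 'b) hardy) w = - hcoeff f w"
  by (simp add: uminus_hardy_def hcoeff_Hardy hcoeff_summable)
lemma hcoeff_minus: "hcoeff (f - g :: ('a, 'b) hardy) w = hcoeff f w - hcoeff g w"
  by (simp add: minus_hardy_def hcoeff_plus hcoeff_uminus)

lemma cinner_hcoeff_summable:
  "(\<lambda>w. cinner (hcoeff f w) (hcoeff (g :: ('a, 'b) hardy) w)) summable_on UNIV"
proof (rule abs_summable_summable, rule Infinite_Sum.abs_summable_on_comparison_test')
  show "(\<lambda>w. (norm (hcoeff f w))\<^sup>2 + (norm (hcoeff g w))\<^sup>2) summable_on UNIV"
    by (intro summable_on_add hcoeff_summable)
  fix w
  have "0 \<le> norm (hcoeff f w) * norm (hcoeff g w)" by simp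
  then show "cmod (cinner (hcoeff f w) (hcoeff g w)) \<le> (norm (hcoeff f w))\<^sup>2 + (norm (hcoeff g w))\<^sup>2"
    using norm_cinner_le[of "hcoeff f w" "hcoeff g w"]
      sum_squares_bound[of "norm (hcoeff f w)" "norm (hcoeff g w)"] by linarith
qed

lemma inner_hcoeff_summable:
  "(\<lambda>w. inner (hcoeff f w) (hcoeff (g :: ('a, 'b) hardy) w)) summable_on UNIV"
  using summable_on_Re[OF cinner_hcoeff_summable[of f g]] by (simp add: Re_cinner)

lemma norm_hcoeff_sum_le:
  assumes "finite A"
  shows "(\<Sum>w\<in>A. (norm (hcoeff (f :: ('a, 'b) hardy) w))\<^sup>2) \<le> (norm f)\<^sup>2"
proof -
  have "(\<Sum>w\<in>A. (norm (hcoeff f w))\<^sup>2) \<le> (\<Sum>\<^sub>\<infinity>w. (norm (hcoeff f w))\<^sup>2)"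
    by (rule finite_sum_le_infsum) (auto intro: hcoeff_summable assms)
  moreover have "0 \<le> (\<Sum>\<^sub>\<infinity>w. (norm (hcoeff f w))\<^sup>2)" by (intro infsum_nonneg) auto
  ultimately show ?thesis by (simp add: norm_hardy_def)
qed

lemma norm_hcoeff_le: "norm (hcoeff (f :: ('a, 'b) hardy) w) \<le> norm f"
proof -
  have "0 \<le> norm f" by (simp add: norm_hardy_def infsum_nonneg)
  then show ?thesis using norm_hcoeff_sum_le[of "{w}" f] by (simp add: power2_le_iff_abs_le)
qed

instance
proof
  fix f g h :: "('a, 'b) hardy" and r s :: real
  show "f + g + h = f + (g + h)" "f + g = g + f" "0 + f = f" "- f + f = 0" "f - g = f + - g"
    "r *\<^sub>R (f + g) = r *\<^sub>R f + r *\<^sub>R g" "(r + s) *\<^sub>R f = r *\<^sub>R f + s *\<^sub>R f"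
    "r *\<^sub>R s *\<^sub>R f = (r * s) *\<^sub>R f" "1 *\<^sub>R f = f"
    by (auto intro!: hardy_eqI simp: hcoeff_zero hcoeff_plus hcoeff_scaleR hcoeff_uminus
        hcoeff_minus scaleR_add_right scaleR_add_left)
  show "sgn f = inverse (norm f) *\<^sub>R f" by (rule sgn_hardy_def)
  show "dist f g = norm (f - g)" by (rule dist_hardy_def)
  show "(uniformity :: (('a, 'b) hardy \<times> ('a, 'b) hardy) filter) =
      (INF e\<in>{0<..}. principal {(x, y). dist x y < e})" by (rule uniformity_hardy_def)
  show "open U = (\<forall>x\<in>U. \<forall>\<^sub>F (x', y) in uniformity. x' = x \<longrightarrow> y \<in> U)"
    for U :: "('a, 'b) hardy set" by (rule open_hardy_def)
  show "inner f g = inner g f" by (simp add: inner_hardy_def inner_commute)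
  show "inner (f + g) h = inner f h + inner g h"
    by (simp add: inner_hardy_def hcoeff_plus inner_add_left infsum_add inner_hcoeff_summable)
  show "inner (r *\<^sub>R f) g = r * inner f g"
    by (simp add: inner_hardy_def hcoeff_scaleR infsum_cmult_right')
  show ge: "0 \<le> inner f f" by (simp add: inner_hardy_def infsum_nonneg)
  show norm: "norm f = sqrt (inner f f)"
    by (simp add: inner_hardy_def norm_hardy_def power2_norm_eq_inner)
  show "inner f f = 0 \<longleftrightarrow> f = 0"
  proof
    assume "inner f f = 0"
    then have "norm (hcoeff f w) \<le> 0" for w using norm_hcoeff_le[of f w] norm by simp
    then show "f = 0" by (intro hardy_eqI) (simp add: hcoeff_zero)
  next
    assume "f = 0"
    then show "inner f f = 0" by (simp add: inner_hardy_def hcoeff_zero)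
  qed
qed

end

lemmas hcoeff_simps = hcoeff_zero hcoeff_plus hcoeff_scaleR hcoeff_uminus hcoeff_minus

instance hardy :: (type, chilbert_space) complete_space
proof
  fix X :: "nat \<Rightarrow> ('a, 'b) hardy"
  assume X: "Cauchy X"
  have "Cauchy (\<lambda>n. hcoeff (X n) w)" for w
  proof (rule metric_CauchyI)
    fix e :: real assume "e > 0"
    then obtain M where M: "\<forall>m\<ge>M. \<forall>n\<ge>M. dist (X m) (X n) < e"
      using X unfolding Cauchy_def by blast
    have "dist (hcoeff (X m) w) (hcoeff (X n) w) \<le> dist (X m) (X n)" for m n
      using norm_hcoeff_le[of "X m - X n" w] by (simp add: dist_norm dist_hardy_def hcoeff_minus)
    with M show "\<exists>M. \<forall>m\<ge>M. \<forall>n\<ge>M. dist (hcoeff (X m) w) (hcoeff (X n) w) < e"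
      by (meson le_less_trans)
  qed
  then have "\<exists>l. (\<lambda>n. hcoeff (X n) w) \<longlonglongrightarrow> l" for w
    by (simp add: Cauchy_convergent_iff convergent_def)
  then obtain l where l: "\<And>w. (\<lambda>n. hcoeff (X n) w) \<longlonglongrightarrow> l w" by metis
  have key: "\<exists>M. \<forall>m\<ge>M. \<forall>A. finite A \<longrightarrow> (\<Sum>w\<in>A. (norm (hcoeff (X m) w - l w))\<^sup>2) \<le> e\<^sup>2"
    if "e > 0" for e :: real
  proof -
    obtain M where M: "\<And>m n. m \<ge> M \<Longrightarrow> n \<ge> M \<Longrightarrow> dist (X m) (X n) < e"
      using X \<open>e > 0\<close> unfolding Cauchy_def by blast
    have "(\<Sum>w\<in>A. (norm (hcoeff (X m) w - l w))\<^sup>2) \<le> e\<^sup>2" if "m \<ge> M" "finite A" for m A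
    proof (rule LIMSEQ_le_const2)
      show "(\<lambda>n. \<Sum>w\<in>A. (norm (hcoeff (X m) w - hcoeff (X n) w))\<^sup>2)
          \<longlonglongrightarrow> (\<Sum>w\<in>A. (norm (hcoeff (X m) w - l w))\<^sup>2)"
        by (intro tendsto_intros l)
      have "(\<Sum>w\<in>A. (norm (hcoeff (X m) w - hcoeff (X n) w))\<^sup>2) \<le> e\<^sup>2" if "n \<ge> M" for n
      proof -
        have "(\<Sum>w\<in>A. (norm (hcoeff (X m) w - hcoeff (X n) w))\<^sup>2) \<le> (norm (X m - X n))\<^sup>2"
          using norm_hcoeff_sum_le[OF \<open>finite A\<close>, of "X m - X n"] by (simp add: hcoeff_minus)
        also have "\<dots> \<le> e\<^sup>2"
          using M[OF \<open>m \<ge> M\<close> that]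
          by (intro power_mono) (auto simp: dist_hardy_def norm_hardy_def infsum_nonneg)
        finally show ?thesis .
      qed
      then show "\<exists>N. \<forall>n\<ge>N. (\<Sum>w\<in>A. (norm (hcoeff (X m) w - hcoeff (X n) w))\<^sup>2) \<le> e\<^sup>2" by blast
    qed
    then show ?thesis by blast
  qed
  have diff: "(\<lambda>w. (norm (hcoeff (X m) w - l w))\<^sup>2) summable_on UNIV"
    if "\<And>A. finite A \<Longrightarrow> (\<Sum>w\<in>A. (norm (hcoeff (X m) w - l w))\<^sup>2) \<le> e\<^sup>2" for m and e :: real
    by (rule nonneg_bdd_above_summable_on) (auto intro!: bdd_aboveI2[where M = "e\<^sup>2"] that)
  obtain M where "\<forall>A. finite A \<longrightarrow> (\<Sum>w\<in>A. (norm (hcoeff (X M) w - l w))\<^sup>2) \<le> 1\<^sup>2"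
    using key[of 1] by auto
  then have M: "(\<lambda>w. (norm (l w - hcoeff (X M) w))\<^sup>2) summable_on UNIV"
    using diff[of M 1] by (simp add: norm_minus_commute)
  have "(\<lambda>w. (norm (l w))\<^sup>2) summable_on UNIV"
    using square_summable_add[OF M hcoeff_summable[of "X M"]] by simp
  then have L: "hcoeff (Hardy l) = l" by (rule hcoeff_Hardy)
  have "X \<longlonglongrightarrow> Hardy l"
    unfolding tendsto_iff eventually_sequentially
  proof (intro allI impI)
    fix e :: real assume e: "e > 0"
    then obtain N where
      N: "\<forall>m\<ge>N. \<forall>A. finite A \<longrightarrow> (\<Sum>w\<in>A. (norm (hcoeff (X m) w - l w))\<^sup>2) \<le> (e / 2)\<^sup>2"
      using key[of "e / 2"] by auto
    have "dist (X m) (Hardy l) < e" if "m \<ge> N" for m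
    proof -
      have "(\<lambda>w. (norm (hcoeff (X m) w - l w))\<^sup>2) summable_on UNIV"
        using N that by (intro diff[of m "e / 2"]) blast
      then have "(\<Sum>\<^sub>\<infinity>w. (norm (hcoeff (X m) w - l w))\<^sup>2) \<le> (e / 2)\<^sup>2"
        by (rule infsum_le_finite_sums) (use N that in auto)
      then have "dist (X m) (Hardy l) \<le> sqrt ((e / 2)\<^sup>2)"
        unfolding dist_hardy_def norm_hardy_def hcoeff_minus L by (rule real_sqrt_le_mono)
      also have "\<dots> < e" using e by simp
      finally show ?thesis .
    qed
    then show "\<exists>N. \<forall>m\<ge>N. dist (X m) (Hardy l) < e" by blast
  qed
  then show "convergent X" by (auto simp: convergent_def)
qed

instantiation hardy :: (type, chilbert_space) chilbert_space
begin

definition scaleC_hardy :: "complex \<Rightarrow> ('a, 'b) hardy \<Rightarrow> ('a, 'b) hardy"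
  where "c *\<^sub>C f = Hardy (\<lambda>w. c *\<^sub>C hcoeff f w)"
definition cinner_hardy :: "('a, 'b) hardy \<Rightarrow> ('a, 'b) hardy \<Rightarrow> complex"
  where "cinner f g = (\<Sum>\<^sub>\<infinity>w. cinner (hcoeff f w) (hcoeff g w))"

lemma hcoeff_scaleC: "hcoeff (c *\<^sub>C f :: ('a, 'b) hardy) w = c *\<^sub>C hcoeff f w"
  by (simp add: scaleC_hardy_def hcoeff_Hardy square_summable_scaleC hcoeff_summable)

instance
proof
  fix f g h :: "('a, 'b) hardy" and r :: real and c d :: complex
  show "c *\<^sub>C (f + g) = c *\<^sub>C f + c *\<^sub>C g" "(c + d) *\<^sub>C f = c *\<^sub>C f + d *\<^sub>C f"
    "c *\<^sub>C d *\<^sub>C f = (c * d) *\<^sub>C f" "of_real r *\<^sub>C f = r *\<^sub>R f"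
    by (auto intro!: hardy_eqI simp: hcoeff_simps hcoeff_scaleC scaleC_add_right
        scaleC_add_left scaleC_scaleC scaleC_of_real)
  show "cinner f g = cnj (cinner g f)"
    unfolding cinner_hardy_def infsum_cnj[symmetric] using cinner_commute by metis
  show "cinner f (g + h) = cinner f g + cinner f h"
    by (simp add: cinner_hardy_def hcoeff_plus cinner_add_right infsum_add cinner_hcoeff_summable)
  show "cinner f (c *\<^sub>C g) = c * cinner f g"
    by (simp add: cinner_hardy_def hcoeff_scaleC cinner_scaleC_right infsum_cmult_right')
  show "Re (cinner f g) = inner f g"
    using infsum_Re[OF cinner_hcoeff_summable[of f g]]
    by (simp add: cinner_hardy_def inner_hardy_def Re_cinner)
qed

end

definition hardy_tensor :: "'a::chilbert_space set \<Rightarrow> ('d, 'a) hardy set" where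
  "hardy_tensor F = {f. \<forall>w. hcoeff f w \<in> F}"

text \<open>\<open>right_shift k\<close> is right multiplication by \<open>z_k\<close>, tensored with the identity.\<close>

definition right_shift :: "'d \<Rightarrow> ('d, 'a::chilbert_space) hardy \<Rightarrow> ('d, 'a) hardy" where
  "right_shift k f = Hardy (\<lambda>w. if w \<noteq> [] \<and> last w = k then hcoeff f (butlast w) else 0)"

definition tensor :: "('d, complex) hardy \<Rightarrow> 'a::chilbert_space \<Rightarrow> ('d, 'a) hardy" where
  "tensor h x = Hardy (\<lambda>w. hcoeff h w *\<^sub>C x)"

lemma hcoeff_right_shift:
  "hcoeff (right_shift k f) w = (if w \<noteq> [] \<and> last w = k then hcoeff f (butlast w) else 0)"
proof -
  let ?g = "\<lambda>w. if w \<noteq> [] \<and> last w = k then hcoeff f (butlast w) else 0"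
  have "(\<lambda>w. (norm (?g w))\<^sup>2) \<circ> (\<lambda>v. v @ [k]) = (\<lambda>v. (norm (hcoeff f v))\<^sup>2)"
    by (simp add: fun_eq_iff)
  then have "((\<lambda>w. (norm (?g w))\<^sup>2) \<circ> (\<lambda>v. v @ [k])) summable_on UNIV"
    by (simp only: hcoeff_summable)
  then have "(\<lambda>w. (norm (?g w))\<^sup>2) summable_on range (\<lambda>v. v @ [k])"
    by (subst summable_on_reindex) (auto simp: inj_on_def)
  moreover have "w \<in> range (\<lambda>v. v @ [k])" if "w \<noteq> []" "last w = k" for w
    using append_butlast_last_id[OF that(1)] that(2) by (metis rangeI)
  ultimately have "(\<lambda>w. (norm (?g w))\<^sup>2) summable_on UNIV"
    by (subst summable_on_cong_neutral[where T = "range (\<lambda>v. v @ [k])"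
          and g = "\<lambda>w. (norm (?g w))\<^sup>2"]) auto
  then show ?thesis by (simp add: right_shift_def hcoeff_Hardy)
qed

lemma hcoeff_tensor: "hcoeff (tensor h x) w = hcoeff h w *\<^sub>C x"
proof -
  have "(\<lambda>w. (norm (hcoeff h w *\<^sub>C x))\<^sup>2) summable_on UNIV"
    using summable_on_cmult_left[OF hcoeff_summable[of h], of "(norm x)\<^sup>2"]
    by (simp add: norm_scaleC power_mult_distrib)
  then show ?thesis by (simp add: tensor_def hcoeff_Hardy)
qed

lemma cinner_tensor: "cinner (tensor g x) (tensor h y) = cinner g h * cinner x y"
  unfolding cinner_hardy_def hcoeff_tensor cinner_scaleC_left cinner_scaleC_right
  by (simp add: cinner_complex_def mult_ac infsum_cmult_right')

lemma right_shift_tensor: "right_shift k (tensor h x) = tensor (right_shift k h) x"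
  using scaleC_of_real[of 0 x]
  by (intro hardy_eqI) (simp add: hcoeff_tensor hcoeff_right_shift)

lemma closed_csubspace_hardy_tensor:
  assumes "closed_csubspace F"
  shows "closed_csubspace (hardy_tensor F :: ('d, 'a::chilbert_space) hardy set)"
proof -
  have "closed (hardy_tensor F :: ('d, 'a) hardy set)"
  proof (rule closed_sequential_limits[THEN iffD2], intro allI impI)
    fix f :: "nat \<Rightarrow> ('d, 'a) hardy" and l
    assume f: "(\<forall>n. f n \<in> hardy_tensor F) \<and> f \<longlonglongrightarrow> l"
    have "(\<lambda>n. hcoeff (f n) w) \<longlonglongrightarrow> hcoeff l w" for w
    proof (rule metric_tendsto_imp_tendsto[of f l])
      show "\<forall>\<^sub>F n in sequentially. dist (hcoeff (f n) w) (hcoeff l w) \<le> dist (f n) l"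
        using norm_hcoeff_le[of "f _ - l" w]
        by (auto simp: dist_norm hcoeff_minus)
    qed (use f in simp)
    then have "hcoeff l w \<in> F" for w
      using assms f closed_sequentially[of F "\<lambda>n. hcoeff (f n) w"]
      by (auto simp: closed_csubspace_def hardy_tensor_def)
    then show "l \<in> hardy_tensor F" by (simp add: hardy_tensor_def)
  qed
  with assms show ?thesis
    by (auto simp: closed_csubspace_def hardy_tensor_def hcoeff_simps hcoeff_scaleC)
qed

text \<open>
  Elementary tensors are total; together with \<open>cinner_tensor\<close> this identifies
  \<open>hardy_tensor F\<close> as the Hilbert space tensor product.
\<close>

lemma closure_span_tensor:
  assumes F: "closed_csubspace (F :: 'a::chilbert_space set)"
  shows "closure (span {tensor h x | h x. x \<in> F}) = (hardy_tensor F :: ('d, 'a) hardy set)"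
    (is "closure (span ?E) = _")
proof
  have sub: "subspace (hardy_tensor F :: ('d, 'a) hardy set)"
    using closed_csubspace_hardy_tensor[OF F] unfolding subspace_def closed_csubspace_def
    by (metis scaleC_of_real)
  have "?E \<subseteq> (hardy_tensor F :: ('d, 'a) hardy set)"
    using F by (auto simp: hardy_tensor_def hcoeff_tensor closed_csubspace_def)
  then have "span ?E \<subseteq> (hardy_tensor F :: ('d, 'a) hardy set)" by (rule span_minimal[OF _ sub])
  then show "closure (span ?E) \<subseteq> (hardy_tensor F :: ('d, 'a) hardy set)"
    using closed_csubspace_hardy_tensor[OF F, where 'd = 'd]
    by (intro closure_minimal) (auto simp: closed_csubspace_def)
next
  show "hardy_tensor F \<subseteq> closure (span (?E :: ('d, 'a) hardy set))"
  proof
    fix f :: "('d, 'a) hardy"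
    assume f: "f \<in> hardy_tensor F"
    have sc1: "1 *\<^sub>C x = x" "0 *\<^sub>C x = 0" for x :: 'a
      using scaleC_of_real[of 1 x] scaleC_of_real[of 0 x] by auto
    define u :: "'d list \<Rightarrow> ('d, complex) hardy" where "u v = Hardy (\<lambda>w. if w = v then 1 else 0)" for v
    have u: "hcoeff (u v) w = (if w = v then 1 else 0)" for v w
    proof -
      have "(\<lambda>w. (norm (if w = v then 1 else 0 :: complex))\<^sup>2) summable_on UNIV"
        by (rule finite_nonzero_values_imp_summable_on) (simp add: if_distrib cong: if_cong)
      then show ?thesis by (simp add: u_def hcoeff_Hardy)
    qed
    define g where "g A = (\<Sum>v\<in>A. tensor (u v) (hcoeff f v))" for A
    have g: "hcoeff (g A) w = (if w \<in> A then hcoeff f w else 0)" if "finite A" for A w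
      using that by (induction A)
        (auto simp: g_def hcoeff_simps hcoeff_tensor u sc1)
    have gE: "g A \<in> span ?E" for A
      unfolding g_def using f by (intro span_sum span_base) (auto simp: hardy_tensor_def)
    show "f \<in> closure (span ?E)"
    proof (rule closure_approachable[THEN iffD2], intro allI impI)
      fix e :: real assume e: "e > 0"
      let ?n = "\<lambda>w. (norm (hcoeff f w))\<^sup>2"
      obtain A where A: "finite A" and d: "dist (sum ?n A) (infsum ?n UNIV) \<le> e\<^sup>2 / 2"
        using infsum_finite_approximation[OF hcoeff_summable[of f], of "e\<^sup>2 / 2"] e by auto
      have "(norm (g A - f))\<^sup>2 = infsum (\<lambda>w. (norm (hcoeff (g A - f) w))\<^sup>2) UNIV"
        by (simp add: norm_hardy_def infsum_nonneg)
      also have "\<dots> = infsum ?n (UNIV - A)"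
        by (rule infsum_cong_neutral) (auto simp: hcoeff_minus g[OF A])
      also have "\<dots> = infsum ?n UNIV - sum ?n A"
        using infsum_Diff[OF hcoeff_summable[of f], of A] A by (simp add: summable_on_finite)
      also have "\<dots> < e\<^sup>2" using d e by (simp add: dist_real_def abs_le_iff) (smt (verit) zero_less_power)
      finally have "norm (g A - f) < e" using e by (simp add: power2_less_imp_less)
      then show "\<exists>y\<in>span ?E. dist y f < e" using gE by (auto simp: dist_norm)
    qed
  qed
qed

text \<open>
  Operator-valued left multipliers, as the bounded operators intertwining the right shifts. Values
  of \<open>T\<close> outside \<open>hardy_tensor F\<close> are irrelevant.
\<close>

definition left_multiplier ::
  "'a::chilbert_space set \<Rightarrow> 'b::chilbert_space set \<Rightarrow> (('d, 'a) hardy \<Rightarrow> ('d, 'b) hardy) \<Rightarrow> bool" where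
  "left_multiplier F J T \<longleftrightarrow> bounded_clinear_on (hardy_tensor F) T \<and>
     T ` hardy_tensor F \<subseteq> hardy_tensor J \<and>
     (\<forall>k. \<forall>f\<in>hardy_tensor F. T (right_shift k f) = right_shift k (T f))"

definition mult_range ::
  "'a::chilbert_space set \<Rightarrow> (('d, 'a) hardy \<Rightarrow> ('d, 'b::chilbert_space) hardy) \<Rightarrow>
    ('d, 'b) hardy set \<times> (('d, 'b) hardy \<Rightarrow> real)" where
  "mult_range F T = range_space (hardy_tensor F) T"

end

theory Submission
  imports Defs
begin

text \<open>
  The pairs \<open>(x, y)\<close> with \<open>F x = G y\<close> form a closed subspace \<open>K\<close> of the Hardy space with
  coefficients in \<open>F \<times> G\<close>. It is invariant under the right shifts, and, as the kernel of a multiplier,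
  it also contains \<open>p\<^sub>1, \<dots>, p\<^sub>d\<close> whenever it contains \<open>p\<^sub>1 z\<^sub>1 + \<dots> + p\<^sub>d z\<^sub>d\<close>. As in Beurling's theorem, \<open>K\<close> is
  the range of an isometric multiplier \<open>\<Theta>\<close> with coefficients in the wandering subspace \<open>W\<close>, the
  orthogonal complement in \<open>K\<close> of the elements without constant term. Then \<open>f \<mapsto> F (fst (\<Theta> f))\<close> is the
  required multiplier: its preimages of \<open>h\<close> correspond isometrically to the pairs \<open>(x, y)\<close> with
  \<open>F x = h = G y\<close>, and both norms of \<open>h\<close> are minima over these. A general wandering subspace can have
  larger dimension than the coefficient space, but here the divisibility property makes
  the constant term injective on \<open>W\<close>, whence the dimension bound.
\<close>

section \<open>Orthogonal series\<close>

lemma norm_sum_orthogonal: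
  fixes f :: "'i \<Rightarrow> 'a::real_inner"
  assumes orth: "\<And>i j. i \<in> A \<Longrightarrow> j \<in> A \<Longrightarrow> i \<noteq> j \<Longrightarrow> inner (f i) (f j) = 0"
    and "finite X" "X \<subseteq> A"
  shows "(norm (sum f X))\<^sup>2 = (\<Sum>i\<in>X. (norm (f i))\<^sup>2)"
  using assms by (intro norm_sum_Pythagorean) (auto simp: pairwise_def orthogonal_def)

lemma orthogonal_summable_on:
  fixes f :: "'i \<Rightarrow> 'a::{real_inner, complete_space}"
  assumes orth: "\<And>i j. i \<in> A \<Longrightarrow> j \<in> A \<Longrightarrow> i \<noteq> j \<Longrightarrow> inner (f i) (f j) = 0"
    and summable: "(\<lambda>i. (norm (f i))\<^sup>2) summable_on A"
  shows "f summable_on A"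
proof -
  let ?n = "\<lambda>i. (norm (f i))\<^sup>2"
  have "\<exists>P. eventually P (finite_subsets_at_top A) \<and>
      (\<forall>F F'. P F \<and> P F' \<longrightarrow> dist (sum f F) (sum f F') < e)" if e: "e > 0" for e
  proof -
    obtain X where X: "finite X" "X \<subseteq> A" and d: "dist (sum ?n X) (infsum ?n A) \<le> e\<^sup>2 / 8"
      using infsum_finite_approximation[OF summable, of "e\<^sup>2 / 8"] e by auto
    define P where "P F \<longleftrightarrow> finite F \<and> X \<subseteq> F \<and> F \<subseteq> A" for F
    have near: "dist (sum f F) (sum f X) < e / 2" if "P F" for F
    proof -
      have F: "finite F" "X \<subseteq> F" "F \<subseteq> A" using that by (auto simp: P_def)
      have "sum ?n F \<le> infsum ?n A"
        using F by (intro finite_sum_le_infsum[OF summable]) auto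
      moreover have "(norm (sum f F - sum f X))\<^sup>2 = sum ?n F - sum ?n X"
        using norm_sum_orthogonal[OF orth, where X = "F - X"] F
        by (simp add: sum_diff subset_eq)
      ultimately have "(norm (sum f F - sum f X))\<^sup>2 \<le> e\<^sup>2 / 8"
        using d unfolding dist_real_def by linarith
      also have "\<dots> < (e / 2)\<^sup>2" using e by (simp add: power_divide)
      finally have "norm (sum f F - sum f X) < e / 2" by (rule power2_less_imp_less) (use e in simp)
      then show ?thesis by (simp add: dist_norm)
    qed
    have "eventually P (finite_subsets_at_top A)"
      using X unfolding P_def eventually_finite_subsets_at_top by blast
    moreover have "dist (sum f F) (sum f F') < e" if "P F" "P F'" for F F'
      using dist_triangle2[of "sum f F" "sum f F'" "sum f X"] near[OF that(1)] near[OF that(2)]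
      by linarith
    ultimately show ?thesis by blast
  qed
  then have "cauchy_filter (filtermap (sum f) (finite_subsets_at_top A))"
    by (simp add: cauchy_filter_metric_filtermap)
  \<comment> \<open>The class provides limits of Cauchy sequences only, while the partial sums form
    a net; \<open>complete_uniform\<close> passes to filters.\<close>
  moreover have "complete (UNIV :: 'a set)"
    by (meson Cauchy_convergent UNIV_I complete_def convergent_def)
  ultimately obtain l where "(sum f \<longlongrightarrow> l) (finite_subsets_at_top A)"
    using complete_uniform[where S = UNIV] by (force simp add: filterlim_def)
  then show ?thesis using summable_on_def has_sum_def by blast
qed

text \<open>Pythagoras holds for every finite partial sum, and the norm is continuous along the
  filter of finite subsets.\<close>

lemma norm_orthogonal_infsum:
  fixes f :: "'i \<Rightarrow> 'a::{real_inner, complete_space}"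
  assumes orth: "\<And>i j. i \<in> A \<Longrightarrow> j \<in> A \<Longrightarrow> i \<noteq> j \<Longrightarrow> inner (f i) (f j) = 0"
    and summable: "(\<lambda>i. (norm (f i))\<^sup>2) summable_on A"
  shows "(norm (infsum f A))\<^sup>2 = (\<Sum>\<^sub>\<infinity>i\<in>A. (norm (f i))\<^sup>2)"
proof -
  have "(sum f \<longlongrightarrow> infsum f A) (finite_subsets_at_top A)"
    using orthogonal_summable_on[OF assms] by (rule infsum_tendsto)
  then have "((\<lambda>X. (norm (sum f X))\<^sup>2) \<longlongrightarrow> (norm (infsum f A))\<^sup>2) (finite_subsets_at_top A)"
    by (intro tendsto_intros)
  moreover have "\<forall>\<^sub>F X in finite_subsets_at_top A. (norm (sum f X))\<^sup>2 = (\<Sum>i\<in>X. (norm (f i))\<^sup>2)"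
    by (rule eventually_finite_subsets_at_top_weakI) (rule norm_sum_orthogonal[OF orth])
  ultimately have "((\<lambda>X. \<Sum>i\<in>X. (norm (f i))\<^sup>2) \<longlongrightarrow> (norm (infsum f A))\<^sup>2) (finite_subsets_at_top A)"
    using tendsto_cong by fast
  then show ?thesis
    by (intro infsumI[symmetric]) (simp add: has_sum_def)
qed

section \<open>Operators on complex Hilbert spaces\<close>

lemma cinner_zero_right [simp]: "cinner x (0 :: 'a::chilbert_space) = 0"
  using cinner_diff_right[of x 0 0] by simp

lemma cinner_zero_left [simp]: "cinner (0 :: 'a::chilbert_space) x = 0"
  using cinner_commute[of 0 x] by simp

lemma cinner_sum_right: "cinner (x :: 'a::chilbert_space) (sum f A) = (\<Sum>i\<in>A. cinner x (f i))"
  by (induction A rule: infinite_finite_induct) (auto simp: cinner_add_right)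

lemma cinner_eq_zero_sym: "cinner x y = 0 \<longleftrightarrow> cinner y (x :: 'a::chilbert_space) = 0"
  by (metis cinner_commute complex_cnj_zero)

lemma bounded_linear_scaleC: "bounded_linear ((*\<^sub>C) c :: 'a \<Rightarrow> 'a::chilbert_space)"
  by (rule bounded_linear_intro[where K = "cmod c"])
    (simp_all add: scaleC_add_right scaleC_scaleC norm_scaleC mult.commute flip: scaleC_of_real)

section \<open>Closed subspaces and operators bounded on them\<close>

lemma closed_csubspaceD:
  assumes "closed_csubspace (S :: 'a::chilbert_space set)"
  shows "closed S" "0 \<in> S" "\<And>x y. x \<in> S \<Longrightarrow> y \<in> S \<Longrightarrow> x + y \<in> S" "\<And>c x. x \<in> S \<Longrightarrow> c *\<^sub>C x \<in> S"
    "\<And>x y. x \<in> S \<Longrightarrow> y \<in> S \<Longrightarrow> x - y \<in> S"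
proof -
  show *: "closed S" "0 \<in> S" "\<And>x y. x \<in> S \<Longrightarrow> y \<in> S \<Longrightarrow> x + y \<in> S" "\<And>c x. x \<in> S \<Longrightarrow> c *\<^sub>C x \<in> S"
    using assms by (auto simp: closed_csubspace_def)
  show "x - y \<in> S" if "x \<in> S" "y \<in> S" for x y
    using *(3)[OF that(1) *(4)[OF that(2), of "-1"]] by (simp add: scaleC_minus_one)
qed

lemma closed_csubspace_sum:
  assumes "closed_csubspace (S :: 'a::chilbert_space set)" "\<And>i. i \<in> A \<Longrightarrow> f i \<in> S"
  shows "sum f A \<in> S"
  using assms(2)
  by (induction A rule: infinite_finite_induct) (auto simp: closed_csubspaceD[OF assms(1)])

lemma closed_csubspace_infsum:
  assumes "closed_csubspace (S :: 'a::chilbert_space set)" "\<And>i. i \<in> A \<Longrightarrow> f i \<in> S"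
    "f summable_on A"
  shows "infsum f A \<in> S"
proof (rule Lim_in_closed_set[OF closed_csubspaceD(1)[OF assms(1)]])
  show "(sum f \<longlongrightarrow> infsum f A) (finite_subsets_at_top A)" by (rule infsum_tendsto[OF assms(3)])
  show "\<forall>\<^sub>F X in finite_subsets_at_top A. sum f X \<in> S"
    by (rule eventually_finite_subsets_at_top_weakI)
      (auto intro!: closed_csubspace_sum[OF assms(1)] assms(2))
qed simp

lemma bounded_clinear_onD:
  assumes T: "bounded_clinear_on S (T :: 'a::chilbert_space \<Rightarrow> 'b::chilbert_space)"
    and S: "closed_csubspace S"
  shows "\<And>x y. x \<in> S \<Longrightarrow> y \<in> S \<Longrightarrow> T (x + y) = T x + T y" "\<And>c x. x \<in> S \<Longrightarrow> T (c *\<^sub>C x) = c *\<^sub>C T x"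
    "T 0 = 0" "\<And>x y. x \<in> S \<Longrightarrow> y \<in> S \<Longrightarrow> T (x - y) = T x - T y"
proof -
  show *: "\<And>x y. x \<in> S \<Longrightarrow> y \<in> S \<Longrightarrow> T (x + y) = T x + T y" "\<And>c x. x \<in> S \<Longrightarrow> T (c *\<^sub>C x) = c *\<^sub>C T x"
    using T by (auto simp: bounded_clinear_on_def)
  show "T 0 = 0" using *(1)[of 0 0] closed_csubspaceD(2)[OF S] by simp
  show "T (x - y) = T x - T y" if "x \<in> S" "y \<in> S" for x y
    using *(1)[OF that(1), of "(-1) *\<^sub>C y"] *(2)[OF that(2), of "-1"] that
      closed_csubspaceD(4)[OF S, of y "-1"] by (simp add: scaleC_minus_one)
qed

lemma bounded_clinear_on_sum:
  assumes T: "bounded_clinear_on S (T :: 'a::chilbert_space \<Rightarrow> 'b::chilbert_space)"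
    and S: "closed_csubspace S" and f: "\<And>i. i \<in> A \<Longrightarrow> f i \<in> S"
  shows "T (sum f A) = (\<Sum>i\<in>A. T (f i))"
  using f
proof (induction A rule: infinite_finite_induct)
  case (insert i A)
  then show ?case
    using bounded_clinear_onD(1)[OF T S, of "f i" "sum f A"] closed_csubspace_sum[OF S, of A f]
    by simp
qed (auto simp: bounded_clinear_onD(3)[OF T S])

lemma bounded_clinear_on_bound:
  assumes "bounded_clinear_on S (T :: 'a::chilbert_space \<Rightarrow> 'b::chilbert_space)"
  obtains K where "K \<ge> 0" "\<And>x. x \<in> S \<Longrightarrow> norm (T x) \<le> K * norm x"
proof -
  obtain K where K: "\<And>x. x \<in> S \<Longrightarrow> norm (T x) \<le> K * norm x"
    using assms unfolding bounded_clinear_on_def by metis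
  have "norm (T x) \<le> \<bar>K\<bar> * norm x" if "x \<in> S" for x
    using K[OF that] by (rule order_trans) (simp add: mult_right_mono)
  then show thesis using that[of "\<bar>K\<bar>"] by simp
qed

lemma bounded_clinear_on_compose:
  assumes T: "bounded_clinear_on S T" "T ` S \<subseteq> S'" and U: "bounded_clinear_on S' U"
  shows "bounded_clinear_on S (\<lambda>x. U (T x))"
proof -
  obtain K where K: "K \<ge> 0" "\<And>x. x \<in> S \<Longrightarrow> norm (T x) \<le> K * norm x"
    using bounded_clinear_on_bound[OF T(1)] by metis
  obtain L where L: "L \<ge> 0" "\<And>x. x \<in> S' \<Longrightarrow> norm (U x) \<le> L * norm x"
    using bounded_clinear_on_bound[OF U] by metis
  have "norm (U (T x)) \<le> (L * K) * norm x" if x: "x \<in> S" for x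
  proof -
    have "norm (U (T x)) \<le> L * norm (T x)" using L(2) T(2) x by blast
    also have "\<dots> \<le> L * (K * norm x)" by (rule mult_left_mono[OF K(2)[OF x] L(1)])
    finally show ?thesis by (simp add: mult.assoc)
  qed
  moreover have "U (T (x + y)) = U (T x) + U (T y)" if "x \<in> S" "y \<in> S" for x y
    using that T U unfolding bounded_clinear_on_def by (metis image_subset_iff)
  moreover have "U (T (c *\<^sub>C x)) = c *\<^sub>C U (T x)" if "x \<in> S" for c x
    using that T U unfolding bounded_clinear_on_def by (metis image_subset_iff)
  ultimately show ?thesis unfolding bounded_clinear_on_def by blast
qed

lemma bounded_clinear_on_diff:
  assumes T: "bounded_clinear_on S T" and U: "bounded_clinear_on S U"
  shows "bounded_clinear_on S (\<lambda>x. T x - U x)"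
proof -
  obtain K where K: "\<And>x. x \<in> S \<Longrightarrow> norm (T x) \<le> K * norm x"
    using bounded_clinear_on_bound[OF T] by metis
  obtain L where L: "\<And>x. x \<in> S \<Longrightarrow> norm (U x) \<le> L * norm x"
    using bounded_clinear_on_bound[OF U] by metis
  have "norm (T x - U x) \<le> (K + L) * norm x" if "x \<in> S" for x
    using norm_triangle_ineq4[of "T x" "U x"] K[OF that] L[OF that] by (simp add: distrib_right)
  moreover have "c *\<^sub>C T x - c *\<^sub>C U x = c *\<^sub>C (T x - U x)" for c x
    by (metis bounded_linear.linear bounded_linear_scaleC linear_diff)
  ultimately show ?thesis using T U unfolding bounded_clinear_on_def
    by (metis add_diff_add)
qed

lemma bounded_clinear_on_tendsto:
  assumes T: "bounded_clinear_on S (T :: 'a::chilbert_space \<Rightarrow> 'b::chilbert_space)"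
    and S: "closed_csubspace S" and f: "\<And>n. f n \<in> S" and l: "f \<longlonglongrightarrow> l"
  shows "(\<lambda>n. T (f n)) \<longlonglongrightarrow> T l"
proof -
  have lS: "l \<in> S" using closed_sequentially[OF closed_csubspaceD(1)[OF S]] f l by blast
  obtain K where K: "\<And>x. x \<in> S \<Longrightarrow> norm (T x) \<le> K * norm x"
    using bounded_clinear_on_bound[OF T] by metis
  have "(\<lambda>n. T (f n) - T l) \<longlonglongrightarrow> 0"
  proof (rule Lim_null_comparison)
    show "\<forall>\<^sub>F n in sequentially. norm (T (f n) - T l) \<le> K * norm (f n - l)"
      using K[OF closed_csubspaceD(5)[OF S f lS]] bounded_clinear_onD(4)[OF T S f lS] by simp
    have "(\<lambda>n. f n - l) \<longlonglongrightarrow> 0" using l by (simp add: LIM_zero_iff)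
    then have "(\<lambda>n. norm (f n - l)) \<longlonglongrightarrow> 0" by (rule tendsto_norm_zero)
    then show "(\<lambda>n. K * norm (f n - l)) \<longlonglongrightarrow> 0" by (rule tendsto_mult_right_zero)
  qed
  then show ?thesis by (simp add: LIM_zero_iff)
qed

lemma closed_csubspace_ker_on:
  assumes T: "bounded_clinear_on S (T :: 'a::chilbert_space \<Rightarrow> 'b::chilbert_space)"
    and S: "closed_csubspace S"
  shows "closed_csubspace (ker_on S T)"
proof -
  have "closed (ker_on S T)"
  proof (rule closed_sequential_limits[THEN iffD2], intro allI impI)
    fix f l assume f: "(\<forall>n. f n \<in> ker_on S T) \<and> f \<longlonglongrightarrow> l"
    then have "\<And>n. f n \<in> S" by (simp add: ker_on_def)
    then have "(\<lambda>n. T (f n)) \<longlonglongrightarrow> T l" "l \<in> S"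
      using bounded_clinear_on_tendsto[OF T S] closed_sequentially[OF closed_csubspaceD(1)[OF S]] f
      by blast+
    moreover have "(\<lambda>n. T (f n)) = (\<lambda>_. 0)" using f by (auto simp: ker_on_def)
    ultimately show "l \<in> ker_on S T" by (simp add: ker_on_def LIMSEQ_const_iff)
  qed
  then show ?thesis
    unfolding closed_csubspace_def
    by (auto simp: ker_on_def bounded_clinear_onD[OF T S] closed_csubspaceD[OF S])
qed

text \<open>An isometry preserves distances, so preimages of a convergent sequence are Cauchy; the
  image of their limit is the limit in question.\<close>

lemma closed_isometric_image:
  assumes T: "bounded_clinear_on S (T :: 'a::chilbert_space \<Rightarrow> 'b::chilbert_space)"
    and S: "closed_csubspace S" and iso: "\<And>x. x \<in> S \<Longrightarrow> norm (T x) = norm x"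
  shows "closed_csubspace (T ` S)"
proof -
  have "closed (T ` S)"
  proof (rule closed_sequential_limits[THEN iffD2], intro allI impI)
    fix g l assume g: "(\<forall>n. g n \<in> T ` S) \<and> g \<longlonglongrightarrow> l"
    then have "\<forall>n. \<exists>x\<in>S. g n = T x" by blast
    then obtain f where f: "\<And>n. f n \<in> S" "\<And>n. g n = T (f n)" by metis
    have "dist (f m) (f n) = dist (g m) (g n)" for m n
      using iso[OF closed_csubspaceD(5)[OF S f(1) f(1)], of m n]
        bounded_clinear_onD(4)[OF T S f(1) f(1), of m n] unfolding dist_norm f(2) by metis
    moreover have "Cauchy g" using g by (intro LIMSEQ_imp_Cauchy) blast
    ultimately have "Cauchy f" by (simp add: Cauchy_def)
    then obtain x where x: "f \<longlonglongrightarrow> x" by (auto simp: Cauchy_convergent_iff convergent_def)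
    then have "g \<longlonglongrightarrow> T x" using bounded_clinear_on_tendsto[OF T S f(1) x] by (simp flip: f(2))
    then have "l = T x" using g LIMSEQ_unique by blast
    moreover have "x \<in> S" using closed_sequentially[OF closed_csubspaceD(1)[OF S]] f(1) x by blast
    ultimately show "l \<in> T ` S" by blast
  qed
  moreover have "0 \<in> T ` S" using bounded_clinear_onD(3)[OF T S] closed_csubspaceD(2)[OF S] by force
  moreover have "a + b \<in> T ` S" if "a \<in> T ` S" "b \<in> T ` S" for a b
  proof -
    obtain x y where "x \<in> S" "a = T x" "y \<in> S" "b = T y" using \<open>a \<in> T ` S\<close> \<open>b \<in> T ` S\<close> by blast
    then show ?thesis
      using bounded_clinear_onD(1)[OF T S, of x y] closed_csubspaceD(3)[OF S, of x y] by force
  qed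
  moreover have "c *\<^sub>C a \<in> T ` S" if "a \<in> T ` S" for a c
  proof -
    obtain x where "x \<in> S" "a = T x" using \<open>a \<in> T ` S\<close> by blast
    then show ?thesis
      using bounded_clinear_onD(2)[OF T S, of x c] closed_csubspaceD(4)[OF S, of x c] by force
  qed
  ultimately show ?thesis by (auto simp: closed_csubspace_def)
qed

section \<open>Orthogonal projections and the norm on an operator range\<close>

lemma orth_proj_props:
  assumes "closed_csubspace (M :: 'a::chilbert_space set)"
  shows "orth_proj M x \<in> M" "\<And>m. m \<in> M \<Longrightarrow> cinner m (x - orth_proj M x) = 0"
  using theI'[OF orth_proj_exists1[OF assms, of x]] by (auto simp: orth_proj_def)

lemma orth_proj_eqI:
  assumes "closed_csubspace (M :: 'a::chilbert_space set)"
    and "p \<in> M" "\<And>m. m \<in> M \<Longrightarrow> cinner m (x - p) = 0"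
  shows "orth_proj M x = p"
  unfolding orth_proj_def using assms orth_proj_exists1[OF assms(1), of x]
  by (intro the1_equality) auto

lemma norm_orth_proj_le:
  assumes "closed_csubspace (M :: 'a::chilbert_space set)"
  shows "norm (orth_proj M x) \<le> norm x"
proof -
  define p where "p = orth_proj M x"
  have "inner p (x - p) = 0"
    using orth_proj_props[OF assms] unfolding p_def Re_cinner[symmetric] by simp
  then have "norm (p + (x - p)) ^ 2 = norm p ^ 2 + norm (x - p) ^ 2"
    by (intro norm_add_Pythagorean) (simp add: orthogonal_def)
  then have "(norm p)\<^sup>2 \<le> (norm x)\<^sup>2" by simp
  then show ?thesis by (simp add: p_def)
qed

lemma orth_decomposition:
  assumes "closed_csubspace S" "closed_csubspace M" "M \<subseteq> S" "(x :: 'a::chilbert_space) \<in> S"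
  shows "x - orth_proj M x \<in> orth_compl S M"
proof -
  have "orth_proj M x \<in> S" using assms(3) orth_proj_props(1)[OF assms(2)] by blast
  then show ?thesis
    using orth_proj_props(2)[OF assms(2)] closed_csubspaceD(5)[OF assms(1,4)]
    by (simp add: orth_compl_def)
qed

text \<open>The nontrivial half of the double complement identity inside \<open>S\<close>. The
  residual \<open>x - p\<close> is orthogonal to \<open>p\<close> by construction and to
  \<open>x\<close> by hypothesis, hence to itself.\<close>

lemma mem_of_orthogonal_orth_compl:
  assumes S: "closed_csubspace S" and M: "closed_csubspace M" "M \<subseteq> S"
    and x: "(x :: 'a::chilbert_space) \<in> S" "\<And>y. y \<in> orth_compl S M \<Longrightarrow> cinner y x = 0"
  shows "x \<in> M"
proof -
  define p where "p = orth_proj M x"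
  have y: "x - p \<in> orth_compl S M"
    unfolding p_def by (rule orth_decomposition[OF S M x(1)])
  then have "cinner p (x - p) = 0" using orth_proj_props(1)[OF M(1), of x]
    by (auto simp: orth_compl_def p_def)
  then have "cinner (x - p) p = 0" by (simp add: cinner_eq_zero_sym)
  then have "cinner (x - p) (x - p) = 0" using x(2)[OF y] by (simp add: cinner_diff_right)
  then have "x = p" by (simp add: cinner_self)
  then show ?thesis using orth_proj_props(1)[OF M(1), of x] by (simp add: p_def)
qed

lemma range_space_norm_le:
  assumes S: "closed_csubspace S"
    and T: "bounded_clinear_on S (T :: 'a::chilbert_space \<Rightarrow> 'b::chilbert_space)" and x: "x \<in> S"
  shows "snd (range_space S T) (T x) \<le> norm x"
  unfolding range_space_norm[OF assms]
  by (rule norm_orth_proj_le[OF closed_csubspace_orth_compl[OF S]])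

text \<open>Removing from a preimage its component in the kernel gives the shortest one. With
  \<open>range_space_norm_le\<close>, the range norm of \<open>h\<close> is thus the minimal norm of
  a preimage, the only form in which it is used below.\<close>

lemma range_space_norm_attained:
  assumes S: "closed_csubspace S"
    and T: "bounded_clinear_on S (T :: 'a::chilbert_space \<Rightarrow> 'b::chilbert_space)" and h: "h \<in> T ` S"
  obtains x where "x \<in> S" "T x = h" "norm x = snd (range_space S T) h"
proof -
  obtain y where y: "y \<in> S" "h = T y" using h by blast
  let ?N = "ker_on S T"
  have N: "closed_csubspace ?N" by (rule closed_csubspace_ker_on[OF T S])
  have NS: "?N \<subseteq> S" by (auto simp: ker_on_def)
  define p where "p = orth_proj ?N y"
  have p: "p \<in> ?N" unfolding p_def by (rule orth_proj_props(1)[OF N])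
  have M: "y - p \<in> orth_compl S ?N" unfolding p_def by (rule orth_decomposition[OF S N NS y(1)])
  have "orth_proj (orth_compl S ?N) y = y - p"
    using M p by (intro orth_proj_eqI[OF closed_csubspace_orth_compl[OF S]])
      (auto simp: orth_compl_def cinner_eq_zero_sym)
  then have "norm (y - p) = snd (range_space S T) h"
    by (simp add: range_space_norm[OF S T y(1)] y(2))
  moreover have "y - p \<in> S" using M by (simp add: orth_compl_def)
  moreover have "T (y - p) = h"
    using p y bounded_clinear_onD(4)[OF T S y(1), of p] by (simp add: ker_on_def)
  ultimately show thesis using that by blast
qed

text \<open>Boundedness of \<open>T\<close> makes the set of values bounded above, which a
  real-valued \<open>SUP\<close> requires in order to be an upper bound.\<close>

lemma op_norm_upper:
  assumes T: "bounded_clinear_on S (T :: 'a::chilbert_space \<Rightarrow> 'b::chilbert_space)"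
    and x: "x \<in> S" "norm x \<le> 1"
  shows "norm (T x) \<le> op_norm S T"
proof -
  obtain K where K: "K \<ge> 0" "\<And>x. x \<in> S \<Longrightarrow> norm (T x) \<le> K * norm x"
    using bounded_clinear_on_bound[OF T] by metis
  have "norm (T y) \<le> K" if "y \<in> S" "norm y \<le> 1" for y
    using K(2)[OF that(1)] mult_left_mono[OF that(2) K(1)] by simp
  then show ?thesis
    unfolding op_norm_def using x by (intro cSUP_upper) (auto intro!: bdd_aboveI2[where M = K])
qed

section \<open>The backward shifts\<close>

text \<open>The adjoint of \<open>right_shift k\<close>, as \<open>cinner_right_shift\<close>
  confirms.\<close>

definition right_unshift :: "'d \<Rightarrow> ('d, 'a::chilbert_space) hardy \<Rightarrow> ('d, 'a) hardy" where
  "right_unshift k f = Hardy (\<lambda>w. hcoeff f (w @ [k]))"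

lemma hcoeff_right_unshift: "hcoeff (right_unshift k f) w = hcoeff f (w @ [k])"
proof -
  have "(\<lambda>w. (norm (hcoeff f w))\<^sup>2) summable_on range (\<lambda>v. v @ [k])"
    by (rule summable_on_subset_banach[OF hcoeff_summable]) simp
  then have "(\<lambda>w. (norm (hcoeff f (w @ [k])))\<^sup>2) summable_on UNIV"
    by (subst (asm) summable_on_reindex) (auto simp: inj_on_def o_def)
  then show ?thesis by (simp add: right_unshift_def hcoeff_Hardy)
qed

lemma hcoeff_right_shift_Nil [simp]: "hcoeff (right_shift k f) [] = 0"
  by (simp add: hcoeff_right_shift)

lemma hcoeff_right_shift_snoc [simp]:
  "hcoeff (right_shift k f) (w @ [l]) = (if l = k then hcoeff f w else 0)"
  by (simp add: hcoeff_right_shift)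

text \<open>The relations of a row isometry: each shift is isometric, and distinct shifts have
  orthogonal ranges.\<close>

lemma right_unshift_right_shift:
  "right_unshift l (right_shift k f) = (if l = k then f else 0)"
  by (auto intro!: hardy_eqI simp: hcoeff_right_unshift hcoeff_zero)

text \<open>Appending \<open>k\<close> is an injection from all words onto the words ending in
  \<open>k\<close>, so a sum supported there can be reindexed.\<close>

lemma infsum_over_snoc:
  assumes "h [] = 0" "\<And>w l. l \<noteq> k \<Longrightarrow> h (w @ [l]) = 0"
  shows "infsum h UNIV = (\<Sum>\<^sub>\<infinity>w. h (w @ [k]))"
proof -
  have "h w = 0" if "w \<notin> range (\<lambda>v. v @ [k])" for w
    using that assms by (cases w rule: rev_cases) auto
  then have "infsum h UNIV = infsum h (range (\<lambda>v. v @ [k]))"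
    by (intro infsum_cong_neutral) auto
  then show ?thesis by (simp add: infsum_reindex inj_on_def o_def)
qed

lemma cinner_right_shift: "cinner (right_shift k f) g = cinner f (right_unshift k g)"
  unfolding cinner_hardy_def by (subst infsum_over_snoc[where k = k]) (simp_all add: hcoeff_right_unshift)

lemma inner_right_shift: "inner (right_shift k f) g = inner f (right_unshift k g)"
  by (simp add: cinner_right_shift flip: Re_cinner)

lemma norm_right_shift: "norm (right_shift k f) = norm f"
  by (simp add: norm_eq_sqrt_inner inner_right_shift right_unshift_right_shift)

lemma bounded_linear_right_shift: "bounded_linear (right_shift k)"
  by (rule bounded_linear_intro[where K = 1])
    (auto intro!: hardy_eqI simp: hcoeff_right_shift hcoeff_simps norm_right_shift)

lemma right_shift_scaleC: "right_shift k (c *\<^sub>C f) = c *\<^sub>C right_shift k f"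
  by (auto intro!: hardy_eqI simp: hcoeff_right_shift hcoeff_scaleC)

text \<open>Since \<open>fold\<close> applies the first letter first,
  \<open>fold right_shift w\<close> is right multiplication by the monomial of \<open>w\<close>. The
  last letter is outermost, hence the inductions from the end of the word here and below.\<close>

lemma bounded_linear_fold_right_shift: "bounded_linear (fold right_shift w)"
proof (induction w rule: rev_induct)
  case (snoc k w)
  have "fold right_shift (w @ [k]) = right_shift k \<circ> fold right_shift w" by simp
  then show ?case using bounded_linear_compose[OF bounded_linear_right_shift snoc]
    by (simp add: o_def)
qed (simp add: bounded_linear_ident[unfolded id_def[symmetric]])

lemma fold_right_shift_zero: "fold right_shift w (0 :: ('d, 'a::chilbert_space) hardy) = 0"
  by (rule linear_0[OF bounded_linear.linear[OF bounded_linear_fold_right_shift]])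

lemma fold_right_shift_scaleC: "fold right_shift w (c *\<^sub>C f) = c *\<^sub>C fold right_shift w f"
  by (induction w rule: rev_induct) (simp_all add: right_shift_scaleC)

lemma norm_fold_right_shift: "norm (fold right_shift w f) = norm f"
  by (induction w rule: rev_induct) (simp_all add: norm_right_shift)

lemma linear_right_unshift: "linear (right_unshift k)"
  by (rule linearI) (auto intro!: hardy_eqI simp: hcoeff_right_unshift hcoeff_simps)

lemma hardy_tensor_right_shift:
  assumes "closed_csubspace F" "x \<in> hardy_tensor F"
  shows "right_shift k x \<in> hardy_tensor F"
  using assms by (simp add: hardy_tensor_def hcoeff_right_shift closed_csubspaceD(2))

lemma hardy_tensor_right_unshift:
  "x \<in> hardy_tensor F \<Longrightarrow> right_unshift k x \<in> hardy_tensor F"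
  by (simp add: hardy_tensor_def hcoeff_right_unshift)

text \<open>Every nonempty word has exactly one last letter; finiteness of the alphabet makes the
  decomposition a finite sum.\<close>

lemma sum_right_shift_right_unshift:
  fixes f :: "('d::finite, 'a::chilbert_space) hardy"
  assumes "hcoeff f [] = 0"
  shows "f = (\<Sum>k\<in>UNIV. right_shift k (right_unshift k f))"
proof (rule hardy_eqI)
  fix w
  have hsum: "hcoeff (\<Sum>k\<in>A. g k) w = (\<Sum>k\<in>A. hcoeff (g k) w)"
    for g :: "'d \<Rightarrow> ('d, 'a) hardy" and A
    by (induction A rule: infinite_finite_induct) (auto simp: hcoeff_simps)
  show "hcoeff f w = hcoeff (\<Sum>k\<in>UNIV. right_shift k (right_unshift k f)) w"
    unfolding hsum using assms
    by (cases w rule: rev_cases) (auto simp: hcoeff_right_unshift)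
qed

section \<open>Invariant subspaces that admit division by the variables\<close>

text \<open>A series without constant term is made up of multiples \<open>right_shift k p\<close>;
  \<open>unshift\<close> asks that its quotients \<open>p\<close> stay in \<open>K\<close>. This is
  weaker than invariance under the backward shifts, because nothing is asked of series with a
  constant term.\<close>

locale divisible_invariant_subspace =
  fixes K :: "('d, 'a::chilbert_space) hardy set"
  assumes closed: "closed_csubspace K"
    and shift: "x \<in> K \<Longrightarrow> right_shift k x \<in> K"
    and unshift: "x \<in> K \<Longrightarrow> hcoeff x [] = 0 \<Longrightarrow> right_unshift k x \<in> K"
begin

text \<open>Thanks to \<open>shift\<close> and \<open>unshift\<close> this is the closed span of the
  shifted copies of \<open>K\<close>, whose complement in \<open>K\<close> is the usual wandering
  subspace.\<close>

definition vanishing :: "('d, 'a) hardy set" where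
  "vanishing = {x \<in> K. hcoeff x [] = 0}"

definition wandering :: "('d, 'a) hardy set" where
  "wandering = orth_compl K vanishing"

text \<open>The multiplier \<Theta> of the overview. Its coefficients are themselves series, because
  the wandering subspace lies in the Hardy space; each is multiplied on the right by its
  monomial.\<close>

definition inner_op :: "('d, ('d, 'a) hardy) hardy \<Rightarrow> ('d, 'a) hardy" where
  "inner_op f = (\<Sum>\<^sub>\<infinity>w. fold right_shift w (hcoeff f w))"

lemma closed_csubspace_vanishing: "closed_csubspace vanishing"
proof -
  have "closed {x :: ('d, 'a) hardy. hcoeff x [] = 0}"
  proof (rule closed_sequential_limits[THEN iffD2], intro allI impI)
    fix f and l :: "('d, 'a) hardy"
    assume f: "(\<forall>n. f n \<in> {x. hcoeff x [] = 0}) \<and> f \<longlonglongrightarrow> l"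
    have "norm (hcoeff l []) \<le> norm (f n - l)" for n
      using norm_hcoeff_le[of "f n - l" "[]"] f by (simp add: hcoeff_minus)
    moreover have "(\<lambda>n. norm (f n - l)) \<longlonglongrightarrow> 0"
      using f tendsto_norm_zero LIM_zero by blast
    ultimately have "norm (hcoeff l []) \<le> 0" by (intro LIMSEQ_le_const) auto
    then show "l \<in> {x. hcoeff x [] = 0}" by simp
  qed
  then have "closed (K \<inter> {x. hcoeff x [] = 0})"
    using closed_csubspaceD(1)[OF closed] by (rule closed_Int[rotated])
  then show ?thesis
    using closed_csubspaceD(2-4)[OF closed]
    by (auto simp: closed_csubspace_def vanishing_def Int_def hcoeff_simps hcoeff_scaleC)
qed

lemma vanishing_subset: "vanishing \<subseteq> K"
  by (auto simp: vanishing_def)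

lemma closed_csubspace_wandering: "closed_csubspace wandering"
  unfolding wandering_def by (rule closed_csubspace_orth_compl[OF closed])

lemma wandering_subset: "wandering \<subseteq> K"
  by (auto simp: wandering_def orth_compl_def)

text \<open>Such an \<open>x\<close> lies both in \<open>vanishing\<close> and in its orthogonal
  complement. This injectivity yields the dimension bound.\<close>

lemma wandering_determined_by_constant_term:
  assumes "x \<in> wandering" "hcoeff x [] = 0"
  shows "x = 0"
proof -
  have "cinner x x = 0"
    using assms by (auto simp: wandering_def orth_compl_def vanishing_def)
  then show ?thesis by (simp add: cinner_self)
qed

lemma fold_right_shift_mem: "x \<in> K \<Longrightarrow> fold right_shift w x \<in> K"
  by (induction w rule: rev_induct) (simp_all add: shift)

lemma inner_wandering_shift:
  assumes "x \<in> wandering" "y \<in> K"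
  shows "inner x (fold right_shift (w @ [k]) y) = 0"
proof -
  have "fold right_shift (w @ [k]) y \<in> vanishing"
    using fold_right_shift_mem[OF assms(2), of "w @ [k]"] by (simp add: vanishing_def)
  then have "cinner (fold right_shift (w @ [k]) y) x = 0"
    using assms(1) by (simp only: wandering_def orth_compl_def mem_Collect_eq)
  then show ?thesis by (simp add: cinner_eq_zero_sym flip: Re_cinner)
qed

text \<open>Equal last letters cancel, as shifts are isometric, and different ones give orthogonal
  vectors. Once one word is exhausted, a wandering vector faces a shifted element of
  \<open>K\<close>, which has no constant term.\<close>

lemma wandering_orthogonal:
  assumes "x \<in> wandering" "y \<in> wandering" "v \<noteq> w"
  shows "inner (fold right_shift v x) (fold right_shift w y) = 0"
  using assms(3)
proof (induction v arbitrary: w rule: rev_induct)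
  case Nil
  then obtain u k where "w = u @ [k]" by (cases w rule: rev_cases) auto
  then show ?case using inner_wandering_shift[of x y u k] assms wandering_subset by auto
next
  case (snoc k v)
  note IH = snoc.IH and neq = snoc.prems
  show ?case
  proof (cases w rule: rev_cases)
    case Nil
    then show ?thesis
      using inner_wandering_shift[of y x v k] assms wandering_subset by (auto simp: inner_commute)
  next
    case (snoc u l)
    then show ?thesis using IH[of u] neq
      by (cases "k = l") (auto simp: inner_right_shift right_unshift_right_shift)
  qed
qed

section \<open>The isometric multiplier\<close>

lemma inner_op_terms:
  assumes "f \<in> hardy_tensor wandering"
  shows "\<And>v w. v \<noteq> w \<Longrightarrow>
      inner (fold right_shift v (hcoeff f v)) (fold right_shift w (hcoeff f w)) = 0"
    and "(\<lambda>w. (norm (fold right_shift w (hcoeff f w)))\<^sup>2) summable_on UNIV"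
proof -
  have "hcoeff f w \<in> wandering" for w using assms by (simp add: hardy_tensor_def)
  then show "inner (fold right_shift v (hcoeff f v)) (fold right_shift w (hcoeff f w)) = 0"
    if "v \<noteq> w" for v w using that by (intro wandering_orthogonal)
  show "(\<lambda>w. (norm (fold right_shift w (hcoeff f w)))\<^sup>2) summable_on UNIV"
    unfolding norm_fold_right_shift by (rule hcoeff_summable)
qed

lemma inner_op_summable:
  assumes "f \<in> hardy_tensor wandering"
  shows "(\<lambda>w. fold right_shift w (hcoeff f w)) summable_on UNIV"
  by (rule orthogonal_summable_on[OF inner_op_terms[OF assms]])

lemma norm_inner_op:
  assumes "f \<in> hardy_tensor wandering"
  shows "norm (inner_op f) = norm f"
proof -
  have "(norm (inner_op f))\<^sup>2 = (\<Sum>\<^sub>\<infinity>w. (norm (fold right_shift w (hcoeff f w)))\<^sup>2)"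
    unfolding inner_op_def by (rule norm_orthogonal_infsum[OF inner_op_terms[OF assms]])
  also have "\<dots> = (norm f)\<^sup>2"
    unfolding norm_fold_right_shift norm_hardy_def[of f] by (simp add: infsum_nonneg)
  finally show ?thesis by simp
qed

lemma inner_op_mem:
  assumes "f \<in> hardy_tensor wandering"
  shows "inner_op f \<in> K"
  unfolding inner_op_def using assms wandering_subset
  by (intro closed_csubspace_infsum[OF closed] inner_op_summable fold_right_shift_mem)
    (auto simp: hardy_tensor_def)

lemma bounded_clinear_on_inner_op: "bounded_clinear_on (hardy_tensor wandering) inner_op"
proof -
  have "inner_op (f + g) = inner_op f + inner_op g"
    if "f \<in> hardy_tensor wandering" "g \<in> hardy_tensor wandering" for f g
    unfolding inner_op_def
    by (subst infsum_add[OF inner_op_summable[OF that(1)] inner_op_summable[OF that(2)], symmetric])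
      (simp add: hcoeff_plus linear_add[OF bounded_linear.linear[OF bounded_linear_fold_right_shift]])
  moreover have "inner_op (c *\<^sub>C f) = c *\<^sub>C inner_op f" if "f \<in> hardy_tensor wandering" for c f
    using has_sum_bounded_linear[OF bounded_linear_scaleC has_sum_infsum[OF inner_op_summable[OF that]]]
    unfolding inner_op_def by (intro infsumI) (simp add: hcoeff_scaleC fold_right_shift_scaleC)
  moreover have "norm (inner_op f) \<le> 1 * norm f" if "f \<in> hardy_tensor wandering" for f
    by (simp add: norm_inner_op[OF that])
  ultimately show ?thesis unfolding bounded_clinear_on_def by blast
qed

text \<open>The shifted series is supported on words ending in \<open>k\<close>; after reindexing,
  the outermost shift is continuous and comes out of the sum.\<close>

lemma inner_op_right_shift:
  assumes "f \<in> hardy_tensor wandering"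
  shows "inner_op (right_shift k f) = right_shift k (inner_op f)"
proof -
  have "inner_op (right_shift k f) = (\<Sum>\<^sub>\<infinity>w. right_shift k (fold right_shift w (hcoeff f w)))"
    \<comment> \<open>The one-letter instance, once simplified, says that \<open>right_shift\<close>
      maps 0 to 0; the plain form no longer matches after \<open>fold\<close> is unfolded.\<close>
    unfolding inner_op_def by (subst infsum_over_snoc[where k = k])
      (simp_all add: fold_right_shift_zero fold_right_shift_zero[of "[_]", simplified])
  also have "\<dots> = right_shift k (inner_op f)"
    unfolding inner_op_def
    by (intro infsumI has_sum_bounded_linear[OF bounded_linear_right_shift] has_sum_infsum
        inner_op_summable[OF assms])
  finally show ?thesis .
qed

section \<open>Surjectivity onto the invariant subspace\<close>

lemma wandering_subset_range: "wandering \<subseteq> inner_op ` hardy_tensor wandering"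
proof
  fix x assume x: "x \<in> wandering"
  \<comment> \<open>The constant series with coefficient \<open>x\<close>, which
    \<open>inner_op\<close> sends to \<open>x\<close>.\<close>
  define f where "f = Hardy (\<lambda>w :: 'd list. if w = [] then x else 0)"
  have "(\<lambda>w :: 'd list. (norm (if w = [] then x else 0))\<^sup>2) summable_on UNIV"
    by (rule finite_nonzero_values_imp_summable_on) (simp add: if_distrib cong: if_cong)
  then have f: "hcoeff f w = (if w = [] then x else 0)" for w
    by (simp add: f_def hcoeff_Hardy)
  have "inner_op f = (\<Sum>\<^sub>\<infinity>w\<in>{[]}. fold right_shift w (hcoeff f w))"
    unfolding inner_op_def by (rule infsum_cong_neutral) (auto simp: f fold_right_shift_zero)
  then have "inner_op f = x" by (simp add: f)
  moreover have "f \<in> hardy_tensor wandering"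
    using x closed_csubspaceD(2)[OF closed_csubspace_wandering] by (simp add: hardy_tensor_def f)
  ultimately show "x \<in> inner_op ` hardy_tensor wandering" by blast
qed

text \<open>The range contains \<open>wandering\<close>, so \<open>x\<close> is orthogonal to the
  complement of \<open>vanishing\<close> in \<open>K\<close>.\<close>

lemma orthogonal_range_vanishing:
  assumes "x \<in> K" and orth: "\<And>f. f \<in> hardy_tensor wandering \<Longrightarrow> cinner (inner_op f) x = 0"
  shows "x \<in> vanishing"
proof (rule mem_of_orthogonal_orth_compl[OF closed closed_csubspace_vanishing vanishing_subset])
  show "cinner y x = 0" if "y \<in> orth_compl K vanishing" for y
    using that wandering_subset_range orth unfolding wandering_def[symmetric] by blast
qed fact

text \<open>Such an \<open>x\<close> has no constant term, so its quotients lie in \<open>K\<close>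
  by divisibility. They are again orthogonal to the range, because \<open>inner_op\<close> commutes
  with the shifts. Stripping letters from the end of a word thus reduces each coefficient of
  \<open>x\<close> to a constant term.\<close>

lemma orthogonal_range_eq_zero:
  assumes "x \<in> K" and "\<And>f. f \<in> hardy_tensor wandering \<Longrightarrow> cinner (inner_op f) x = 0"
  shows "x = 0"
proof (rule hardy_eqI)
  fix w
  have "hcoeff x w = 0"
    using assms
  proof (induction w arbitrary: x rule: rev_induct)
    case Nil
    then show ?case using orthogonal_range_vanishing[of x] by (simp add: vanishing_def)
  next
    case (snoc k w)
    then have "x \<in> vanishing" by (intro orthogonal_range_vanishing)
    then have "right_unshift k x \<in> K" by (auto simp: vanishing_def unshift)
    moreover have "cinner (inner_op f) (right_unshift k x) = 0"
      if "f \<in> hardy_tensor wandering" for f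
      using snoc.prems(2)[OF hardy_tensor_right_shift[OF closed_csubspace_wandering that, of k]]
      by (simp add: inner_op_right_shift[OF that] cinner_right_shift)
    ultimately have "hcoeff (right_unshift k x) w = 0" by (rule snoc.IH)
    then show ?case by (simp add: hcoeff_right_unshift)
  qed
  then show "hcoeff x w = hcoeff 0 w" by (simp add: hcoeff_zero)
qed

text \<open>The range is closed, being an isometric image, so each element of \<open>K\<close> has a
  projection onto it; the residual is orthogonal to the range and hence zero.\<close>

lemma range_inner_op: "inner_op ` hardy_tensor wandering = K"
proof
  let ?R = "inner_op ` hardy_tensor wandering"
  show sub: "?R \<subseteq> K" using inner_op_mem by blast
  have R: "closed_csubspace ?R"
    by (intro closed_isometric_image bounded_clinear_on_inner_op norm_inner_op
        closed_csubspace_hardy_tensor closed_csubspace_wandering)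
  show "K \<subseteq> ?R"
  proof
    fix x assume x: "x \<in> K"
    have "x - orth_proj ?R x \<in> orth_compl K ?R"
      by (rule orth_decomposition[OF closed R sub x])
    then have "x - orth_proj ?R x = 0"
      by (intro orthogonal_range_eq_zero) (auto simp: orth_compl_def)
    then show "x \<in> ?R" using orth_proj_props(1)[OF R, of x] by simp
  qed
qed

end

section \<open>Comparison of Hilbert space dimensions\<close>

text \<open>Gaussian elimination: equation \<open>j\<close> serves to remove an unknown
  \<open>p\<close>, leaving one equation and one unknown fewer.\<close>

lemma underdetermined_system:
  fixes \<phi> :: "'i \<Rightarrow> 'c \<Rightarrow> 'k::field"
  assumes "finite I" "finite C" "card I < card C"
  shows "\<exists>a. (\<exists>c\<in>C. a c \<noteq> 0) \<and> (\<forall>i\<in>I. (\<Sum>c\<in>C. a c * \<phi> i c) = 0)"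
  using assms
proof (induction I arbitrary: C \<phi> rule: finite_induct)
  case empty
  then show ?case by (intro exI[of _ "\<lambda>_. 1"]) (auto simp: card_gt_0_iff)
next
  case (insert j I)
  show ?case
  proof (cases "\<forall>c\<in>C. \<phi> j c = 0")
    case True
    have "card I < card C" using insert by simp
    then obtain a where "\<exists>c\<in>C. a c \<noteq> 0" "\<forall>i\<in>I. (\<Sum>c\<in>C. a c * \<phi> i c) = 0"
      using insert.IH[OF insert.prems(1)] by blast
    moreover have "(\<Sum>c\<in>C. a c * \<phi> j c) = 0" using True by simp
    ultimately show ?thesis by blast
  next
    case False
    then obtain p where p: "p \<in> C" "\<phi> j p \<noteq> 0" by blast
    define D where "D = C - {p}"
    \<comment> \<open>The coefficients left after subtracting the multiple of equation
      \<open>j\<close> that cancels \<open>p\<close>.\<close>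
    define \<psi> where "\<psi> i c = \<phi> i c - \<phi> i p * \<phi> j c / \<phi> j p" for i c
    have D: "finite D" "card I < card D" "p \<notin> D" "C = insert p D"
      using insert p by (auto simp: D_def)
    obtain a where a: "\<exists>c\<in>D. a c \<noteq> 0" "\<forall>i\<in>I. (\<Sum>c\<in>D. a c * \<psi> i c) = 0"
      using insert.IH[OF D(1,2)] by blast
    \<comment> \<open>The value at \<open>p\<close> is the one that solves equation
      \<open>j\<close>.\<close>
    define b where "b = a(p := - (\<Sum>c\<in>D. a c * \<phi> j c) / \<phi> j p)"
    have bD: "(\<Sum>c\<in>D. b c * \<phi> i c) = (\<Sum>c\<in>D. a c * \<phi> i c)" for i
      using D(3) by (intro sum.cong) (auto simp: b_def)
    have split: "(\<Sum>c\<in>C. b c * \<phi> i c) =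
        (\<Sum>c\<in>D. a c * \<phi> i c) - (\<Sum>c\<in>D. a c * \<phi> j c) / \<phi> j p * \<phi> i p" for i
      using D(1,3) by (simp add: D(4) bD) (simp add: b_def)
    have "(\<Sum>c\<in>C. b c * \<phi> i c) = (\<Sum>c\<in>D. a c * \<psi> i c)" for i
      unfolding split \<psi>_def
      by (simp add: right_diff_distrib sum_subtractf sum_divide_distrib sum_distrib_right)
        (simp add: mult_ac)
    then have "\<forall>i\<in>I. (\<Sum>c\<in>C. b c * \<phi> i c) = 0" using a(2) by simp
    moreover have "(\<Sum>c\<in>C. b c * \<phi> j c) = 0" using split[of j] p(2) by simp
    moreover have "\<exists>c\<in>C. b c \<noteq> 0" using a(1) D(3,4) by (auto simp: b_def)
    ultimately show ?thesis by blast
  qed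
qed

lemma cinner_orthonormal_sum:
  fixes X :: "'a::chilbert_space set"
  assumes "\<And>x y. x \<in> X \<Longrightarrow> y \<in> X \<Longrightarrow> cinner x y = (if x = y then 1 else 0)" "finite X" "x \<in> X"
  shows "cinner x (\<Sum>c\<in>X. a c *\<^sub>C c) = a x"
proof -
  have "cinner x (\<Sum>c\<in>X. a c *\<^sub>C c) = (\<Sum>c\<in>X. if x = c then a c else 0)"
    unfolding cinner_sum_right cinner_scaleC_right by (intro sum.cong) (auto simp: assms)
  then show ?thesis using assms(2,3) by simp
qed

text \<open>Bessel's inequality bounds the sum of the squares of the values of \<phi> over
  \<open>C\<close>, and a summable real family has countable support.\<close>

lemma countable_orthonormal_support:
  fixes \<phi> :: "'a::chilbert_space \<Rightarrow> complex"
  assumes W: "closed_csubspace W" and \<phi>: "bounded_clinear_on W \<phi>" and C: "C \<subseteq> W"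
    and on: "\<And>x y. x \<in> C \<Longrightarrow> y \<in> C \<Longrightarrow> cinner x y = (if x = y then 1 else 0)"
  shows "countable {c\<in>C. \<phi> c \<noteq> 0}"
proof -
  obtain K where K: "K \<ge> 0" "\<And>x. x \<in> W \<Longrightarrow> norm (\<phi> x) \<le> K * norm x"
    using bounded_clinear_on_bound[OF \<phi>] by metis
  have "(\<Sum>c\<in>X. (cmod (\<phi> c))\<^sup>2) \<le> K\<^sup>2" if X: "finite X" "X \<subseteq> C" for X
  proof -
    have onX: "cinner x y = (if x = y then 1 else 0)" if "x \<in> X" "y \<in> X" for x y
      using on[of x y] that X(2) by blast
    define s where "s = (\<Sum>c\<in>X. (cmod (\<phi> c))\<^sup>2)"
    \<comment> \<open>This test vector represents \<phi> on the span of \<open>X\<close>, so both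
      \<phi> \<open>x\<close> and its squared norm equal \<open>s\<close>; boundedness of \<phi>
      then gives \<open>s * s\<close> \<le> \<open>K\<^sup>2 * s\<close>.\<close>
    define x where "x = (\<Sum>c\<in>X. cnj (\<phi> c) *\<^sub>C c)"
    have summand: "cnj (\<phi> c) *\<^sub>C c \<in> W" if "c \<in> X" for c
      using that X C by (intro closed_csubspaceD(4)[OF W]) auto
    have s: "complex_of_real s = (\<Sum>c\<in>X. cnj (\<phi> c) * \<phi> c)"
      unfolding s_def of_real_sum by (intro sum.cong)
        (simp_all add: complex_norm_square mult.commute del: of_real_power)
    have "\<phi> x = (\<Sum>c\<in>X. \<phi> (cnj (\<phi> c) *\<^sub>C c))"
      unfolding x_def by (rule bounded_clinear_on_sum[OF \<phi> W summand])
    also have "\<dots> = (\<Sum>c\<in>X. cnj (\<phi> c) * \<phi> c)"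
      using X C bounded_clinear_onD(2)[OF \<phi> W] by (intro sum.cong) (auto simp: scaleC_complex_def)
    finally have \<phi>x: "\<phi> x = of_real s" by (simp add: s)
    have cx: "cinner c x = cnj (\<phi> c)" if "c \<in> X" for c
      unfolding x_def by (rule cinner_orthonormal_sum[OF onX X(1) that])
    have "cinner x x = (\<Sum>c\<in>X. cnj (\<phi> c) * cinner x c)"
      by (subst (2) x_def) (simp add: cinner_sum_right cinner_scaleC_right)
    also have "\<dots> = of_real s"
      unfolding s using cx by (intro sum.cong) (auto simp: cinner_commute[of x])
    finally have nx: "(norm x)\<^sup>2 = s" by (simp only: cinner_self of_real_eq_iff)
    have s0: "s \<ge> 0" by (simp add: s_def sum_nonneg)
    have "x \<in> W" unfolding x_def by (rule closed_csubspace_sum[OF W summand])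
    then have "s \<le> K * norm x" using K(2)[of x] s0 by (simp add: \<phi>x)
    then have "s\<^sup>2 \<le> (K * norm x)\<^sup>2" using s0 by (intro power_mono)
    then have "s * s \<le> K\<^sup>2 * s" by (simp add: power_mult_distrib nx flip: power2_eq_square)
    then have "s \<le> K\<^sup>2" using s0 by (cases "s = 0") auto
    then show ?thesis by (simp add: s_def)
  qed
  then have "(\<lambda>c. (cmod (\<phi> c))\<^sup>2) summable_on C"
    by (intro nonneg_bdd_above_summable_on bdd_aboveI2[where M = "K\<^sup>2"]) auto
  from summable_countable_real[OF this] show ?thesis by simp
qed

text \<open>For finite \<open>I\<close>, more vectors than functionals would admit a nontrivial
  combination killed by all functionals. For infinite \<open>I\<close>, every element of
  \<open>C\<close> is detected by some functional and each functional detects only countably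
  many.\<close>

lemma card_orthonormal_le_separating:
  fixes \<phi> :: "'i \<Rightarrow> 'a::chilbert_space \<Rightarrow> complex"
  assumes W: "closed_csubspace W" and \<phi>: "\<And>i. i \<in> I \<Longrightarrow> bounded_clinear_on W (\<phi> i)"
    and sep: "\<And>x. x \<in> W \<Longrightarrow> (\<And>i. i \<in> I \<Longrightarrow> \<phi> i x = 0) \<Longrightarrow> x = 0"
    and C: "C \<subseteq> W"
    and on: "\<And>x y. x \<in> C \<Longrightarrow> y \<in> C \<Longrightarrow> cinner x y = (if x = y then 1 else 0)"
  shows "|C| \<le>o |I|"
proof (cases "finite I")
  case True
  have le: "card X \<le> card I" if X: "finite X" "X \<subseteq> C" for X
  proof (rule ccontr)
    assume "\<not> card X \<le> card I"
    then obtain a where a: "\<exists>c\<in>X. a c \<noteq> 0" "\<forall>i\<in>I. (\<Sum>c\<in>X. a c * \<phi> i c) = 0"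
      using underdetermined_system[OF True X(1), of \<phi>] by auto
    define x where "x = (\<Sum>c\<in>X. a c *\<^sub>C c)"
    have summand: "a c *\<^sub>C c \<in> W" if "c \<in> X" for c
      using that X C by (intro closed_csubspaceD(4)[OF W]) auto
    have xW: "x \<in> W" unfolding x_def by (rule closed_csubspace_sum[OF W summand])
    have "\<phi> i x = 0" if i: "i \<in> I" for i
    proof -
      have "\<phi> i x = (\<Sum>c\<in>X. \<phi> i (a c *\<^sub>C c))"
        unfolding x_def by (rule bounded_clinear_on_sum[OF \<phi>[OF i] W summand])
      also have "\<dots> = (\<Sum>c\<in>X. a c * \<phi> i c)"
        using X C bounded_clinear_onD(2)[OF \<phi>[OF i] W]
        by (intro sum.cong) (auto simp: scaleC_complex_def)
      finally show ?thesis using a(2) i by simp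
    qed
    then have "x = 0" by (rule sep[OF xW])
    moreover have "cinner c x = a c" if c: "c \<in> X" for c
      unfolding x_def using on X(2) by (intro cinner_orthonormal_sum[OF _ X(1) c]) blast
    ultimately have "a c = 0" if "c \<in> X" for c
      using that by (metis cinner_zero_right)
    then show False using a(1) by blast
  qed
  \<comment> \<open>An infinite set has \<open>card\<close> 0, so finiteness must be settled before
    comparing cardinalities.\<close>
  have "finite C"
  proof (rule ccontr)
    assume "infinite C"
    then obtain X where "X \<subseteq> C" "finite X" "card X = Suc (card I)"
      using infinite_arbitrarily_large by blast
    then show False using le[of X] by simp
  qed
  then have "\<exists>f. f ` C \<subseteq> I \<and> inj_on f C" using le[of C] True by (intro card_le_inj) auto
  then show ?thesis unfolding card_of_ordLeq[symmetric] by blast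
next
  case False
  define D where "D i = {c\<in>C. \<phi> i c \<noteq> 0}" for i
  have "\<exists>i\<in>I. \<phi> i c \<noteq> 0" if c: "c \<in> C" for c
  proof (rule ccontr)
    assume "\<not> ?thesis"
    then have "c = 0" using sep[of c] c C by blast
    then show False using on[OF c c] by simp
  qed
  then have "C = (\<Union>i\<in>I. D i)" by (auto simp: D_def)
  moreover have "|D i| \<le>o |I|" if i: "i \<in> I" for i
  proof -
    obtain f :: "'a \<Rightarrow> nat" where "inj_on f (D i)"
      using countable_orthonormal_support[OF W \<phi>[OF i] C on] by (auto simp: D_def countable_def)
    then have "|D i| \<le>o |UNIV :: nat set|" unfolding card_of_ordLeq[symmetric] by blast
    then show ?thesis using False infinite_iff_card_of_nat ordLeq_transitive by blast
  qed
  ultimately show ?thesis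
    using card_of_UNION_ordLeq_infinite[OF False card_of_mono1[OF order_refl], of D] by simp
qed

text \<open>The coordinates of \<open>A x\<close> and \<open>B x\<close> with respect to bases of
  \<open>F\<close> and \<open>G\<close> form a separating family indexed by the disjoint union of
  these bases. Joint injectivity suffices; no bounded inverse is involved.\<close>

lemma hilbert_dim_le_prod:
  assumes W: "closed_csubspace W" and F: "closed_csubspace F" and G: "closed_csubspace G"
    and A: "bounded_clinear_on W A" "A ` W \<subseteq> F" and B: "bounded_clinear_on W B" "B ` W \<subseteq> G"
    and inj: "\<And>x. x \<in> W \<Longrightarrow> A x = 0 \<Longrightarrow> B x = 0 \<Longrightarrow> x = 0"
  shows "hilbert_dim W \<le>o hilbert_dim F +c hilbert_dim G"
proof -
  define BW where "BW = (SOME B. is_onb W B)"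
  define BF where "BF = (SOME B. is_onb F B)"
  define BG where "BG = (SOME B. is_onb G B)"
  have onb: "is_onb W BW" "is_onb F BF" "is_onb G BG"
    unfolding BW_def BF_def BG_def using onb_exists[OF W] onb_exists[OF F] onb_exists[OF G]
    by (metis someI_ex)+
  define \<phi> where "\<phi> = case_sum (\<lambda>b x. cinner b (A x)) (\<lambda>b x. cinner b (B x))"
  have cinner: "bounded_clinear_on UNIV (cinner b)" for b :: "'z::chilbert_space"
    unfolding bounded_clinear_on_def
    by (auto simp: cinner_add_right cinner_scaleC_right scaleC_complex_def
        intro!: exI[of _ "norm b"] norm_cinner_le)
  have \<phi>: "bounded_clinear_on W (\<phi> i)" for i
    unfolding \<phi>_def
    by (cases i) (auto intro: bounded_clinear_on_compose[OF A(1) _ cinner]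
        bounded_clinear_on_compose[OF B(1) _ cinner])
  have "|BW| \<le>o |BF <+> BG|"
  proof (rule card_orthonormal_le_separating[OF W \<phi>])
    fix x assume x: "x \<in> W" and zero: "\<And>i. i \<in> BF <+> BG \<Longrightarrow> \<phi> i x = 0"
    have "cinner b (A x) = 0" if "b \<in> BF" for b
      using zero[of "Inl b"] that by (auto simp: \<phi>_def)
    then have "A x = 0" using onb(2) A(2) x unfolding is_onb_def by blast
    moreover have "cinner b (B x) = 0" if "b \<in> BG" for b
      using zero[of "Inr b"] that by (auto simp: \<phi>_def)
    then have "B x = 0" using onb(3) B(2) x unfolding is_onb_def by blast
    ultimately show "x = 0" by (rule inj[OF x])
  qed (use onb(1) in \<open>auto simp: is_onb_def\<close>)
  then show ?thesis
    by (simp add: hilbert_dim_def csum_def Field_card_of BW_def BF_def BG_def)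
qed


section \<open>Components of vector-valued series\<close>

lemma norm_fst_le_norm: "norm (fst p) \<le> norm p"
  by (metis norm_fst_le prod.collapse)

lemma norm_snd_le_norm: "norm (snd p) \<le> norm p"
  by (metis norm_snd_le prod.collapse)

definition hardy_fst :: "('d, 'a::chilbert_space \<times> 'b::chilbert_space) hardy \<Rightarrow> ('d, 'a) hardy" where
  "hardy_fst z = Hardy (\<lambda>w. fst (hcoeff z w))"

definition hardy_snd :: "('d, 'a::chilbert_space \<times> 'b::chilbert_space) hardy \<Rightarrow> ('d, 'b) hardy" where
  "hardy_snd z = Hardy (\<lambda>w. snd (hcoeff z w))"

lemma hcoeff_hardy_fst: "hcoeff (hardy_fst z) w = fst (hcoeff z w)"
proof -
  have "(\<lambda>w. (norm (fst (hcoeff z w)))\<^sup>2) summable_on UNIV"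
    by (rule summable_on_comparison_test[OF hcoeff_summable[of z]])
      (auto intro: power_mono norm_fst_le_norm)
  then show ?thesis by (simp add: hardy_fst_def hcoeff_Hardy)
qed

lemma hcoeff_hardy_snd: "hcoeff (hardy_snd z) w = snd (hcoeff z w)"
proof -
  have "(\<lambda>w. (norm (snd (hcoeff z w)))\<^sup>2) summable_on UNIV"
    by (rule summable_on_comparison_test[OF hcoeff_summable[of z]])
      (auto intro: power_mono norm_snd_le_norm)
  then show ?thesis by (simp add: hardy_snd_def hcoeff_Hardy)
qed

text \<open>With \<open>norm_hardy_prod\<close>, this identifies series over a product of
  coefficient spaces with the orthogonal sum of two Hardy spaces.\<close>

lemma hardy_pair_exists:
  obtains z where "hardy_fst z = x" "hardy_snd z = y"
proof -
  let ?z = "Hardy (\<lambda>w. (hcoeff x w, hcoeff y w))"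
  have "(\<lambda>w. (norm (hcoeff x w, hcoeff y w))\<^sup>2) summable_on UNIV"
    by (simp add: norm_Pair summable_on_add hcoeff_summable)
  then have "hcoeff ?z w = (hcoeff x w, hcoeff y w)" for w by (simp add: hcoeff_Hardy)
  then have "hardy_fst ?z = x" "hardy_snd ?z = y"
    by (auto intro!: hardy_eqI simp: hcoeff_hardy_fst hcoeff_hardy_snd)
  then show thesis by (rule that)
qed

lemma power2_norm_hardy: "(norm f)\<^sup>2 = (\<Sum>\<^sub>\<infinity>w. (norm (hcoeff f w))\<^sup>2)"
  unfolding norm_hardy_def by (simp add: infsum_nonneg)

lemma norm_hardy_prod: "(norm z)\<^sup>2 = (norm (hardy_fst z))\<^sup>2 + (norm (hardy_snd z))\<^sup>2"
proof -
  have "(norm (hcoeff z w))\<^sup>2 = (norm (hcoeff (hardy_fst z) w))\<^sup>2 + (norm (hcoeff (hardy_snd z) w))\<^sup>2" for w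
    by (simp add: norm_prod_def hcoeff_hardy_fst hcoeff_hardy_snd)
  then show ?thesis
    unfolding power2_norm_hardy by (simp add: infsum_add hcoeff_summable)
qed

lemma norm_hardy_fst_le: "norm (hardy_fst z) \<le> norm z"
  by (rule power2_le_imp_le) (simp_all add: norm_hardy_prod[of z])

lemma norm_hardy_snd_le: "norm (hardy_snd z) \<le> norm z"
  by (rule power2_le_imp_le) (simp_all add: norm_hardy_prod[of z])

lemma bounded_clinear_on_hardy_fst: "bounded_clinear_on S hardy_fst"
  unfolding bounded_clinear_on_def
  by (auto intro!: hardy_eqI exI[of _ 1] norm_hardy_fst_le
      simp: hcoeff_hardy_fst hcoeff_simps hcoeff_scaleC scaleC_prod_def)

lemma bounded_clinear_on_hardy_snd: "bounded_clinear_on S hardy_snd"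
  unfolding bounded_clinear_on_def
  by (auto intro!: hardy_eqI exI[of _ 1] norm_hardy_snd_le
      simp: hcoeff_hardy_snd hcoeff_simps hcoeff_scaleC scaleC_prod_def)

lemma hardy_fst_right_shift: "hardy_fst (right_shift k z) = right_shift k (hardy_fst z)"
  by (auto intro!: hardy_eqI simp: hcoeff_hardy_fst hcoeff_right_shift)

lemma hardy_snd_right_shift: "hardy_snd (right_shift k z) = right_shift k (hardy_snd z)"
  by (auto intro!: hardy_eqI simp: hcoeff_hardy_snd hcoeff_right_shift)

lemma hardy_fst_right_unshift: "hardy_fst (right_unshift k z) = right_unshift k (hardy_fst z)"
  by (auto intro!: hardy_eqI simp: hcoeff_hardy_fst hcoeff_right_unshift)

lemma hardy_snd_right_unshift: "hardy_snd (right_unshift k z) = right_unshift k (hardy_snd z)"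
  by (auto intro!: hardy_eqI simp: hcoeff_hardy_snd hcoeff_right_unshift)

lemma hardy_tensor_Times:
  "z \<in> hardy_tensor (F \<times> G) \<longleftrightarrow> hardy_fst z \<in> hardy_tensor F \<and> hardy_snd z \<in> hardy_tensor G"
  by (auto simp: hardy_tensor_def hcoeff_hardy_fst hcoeff_hardy_snd mem_Times_iff)

lemma closed_csubspace_Times:
  assumes "closed_csubspace F" "closed_csubspace G"
  shows "closed_csubspace (F \<times> G)"
  using assms by (auto simp: closed_csubspace_def closed_Times scaleC_prod_def zero_prod_def)

section \<open>The kernel of a pair of multipliers\<close>

text \<open>The ranges of the right shifts being orthogonal, a multiplier commutes with division on the
  series without constant term.\<close>

lemma left_multiplier_right_unshift:
  fixes T :: "('d::finite, 'a::chilbert_space) hardy \<Rightarrow> ('d, 'b::chilbert_space) hardy"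
  assumes T: "left_multiplier F J T" and F: "closed_csubspace F"
    and x: "x \<in> hardy_tensor F" "hcoeff x [] = 0"
  shows "T (right_unshift k x) = right_unshift k (T x)"
proof -
  have lin: "bounded_clinear_on (hardy_tensor F) T" using T by (simp add: left_multiplier_def)
  have mem: "right_unshift l x \<in> hardy_tensor F" for l
    by (rule hardy_tensor_right_unshift[OF x(1)])
  have "T x = T (\<Sum>l\<in>UNIV. right_shift l (right_unshift l x))"
    using sum_right_shift_right_unshift[OF x(2)] by simp
  also have "\<dots> = (\<Sum>l\<in>UNIV. T (right_shift l (right_unshift l x)))"
    by (intro bounded_clinear_on_sum[OF lin closed_csubspace_hardy_tensor[OF F]]
        hardy_tensor_right_shift[OF F] mem)
  also have "\<dots> = (\<Sum>l\<in>UNIV. right_shift l (T (right_unshift l x)))"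
    using T mem by (simp add: left_multiplier_def)
  finally have "right_unshift k (T x) =
      (\<Sum>l\<in>UNIV. right_unshift k (right_shift l (T (right_unshift l x))))"
    by (simp add: linear_sum[OF linear_right_unshift])
  \<comment> \<open>Only the summand with \<open>l = k\<close> survives.\<close>
  then show ?thesis by (simp add: right_unshift_right_shift)
qed

text \<open>The set is the kernel of a difference of two bounded operators that commute with the
  shifts, hence closed and invariant. Divisibility comes from
  \<open>left_multiplier_right_unshift\<close> applied to each component.\<close>

lemma divisible_invariant_pair_kernel:
  fixes TF :: "('d::finite, 'f::chilbert_space) hardy \<Rightarrow> ('d, 'j::chilbert_space) hardy"
    and TG :: "('d, 'g::chilbert_space) hardy \<Rightarrow> ('d, 'j) hardy"
  assumes F: "closed_csubspace F" and G: "closed_csubspace G"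
    and TF: "left_multiplier F J TF" and TG: "left_multiplier G J TG"
  shows "divisible_invariant_subspace
    {z \<in> hardy_tensor (F \<times> G). TF (hardy_fst z) = TG (hardy_snd z)}" (is "divisible_invariant_subspace ?K")
proof
  let ?S = "hardy_tensor (F \<times> G) :: ('d, 'f \<times> 'g) hardy set"
  have S: "closed_csubspace ?S"
    by (intro closed_csubspace_hardy_tensor closed_csubspace_Times F G)
  have "bounded_clinear_on ?S (\<lambda>z. TF (hardy_fst z))"
    using TF by (intro bounded_clinear_on_compose[OF bounded_clinear_on_hardy_fst, where S' = "hardy_tensor F"])
      (auto simp: hardy_tensor_Times left_multiplier_def)
  moreover have "bounded_clinear_on ?S (\<lambda>z. TG (hardy_snd z))"
    using TG by (intro bounded_clinear_on_compose[OF bounded_clinear_on_hardy_snd, where S' = "hardy_tensor G"])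
      (auto simp: hardy_tensor_Times left_multiplier_def)
  ultimately have "closed_csubspace (ker_on ?S (\<lambda>z. TF (hardy_fst z) - TG (hardy_snd z)))"
    by (intro closed_csubspace_ker_on[OF _ S] bounded_clinear_on_diff)
  then show "closed_csubspace ?K" by (simp add: ker_on_def)
next
  fix z k assume z: "z \<in> ?K"
  then show "right_shift k z \<in> ?K"
    using TF TG hardy_tensor_right_shift[OF F] hardy_tensor_right_shift[OF G]
    by (auto simp: hardy_tensor_Times hardy_fst_right_shift hardy_snd_right_shift left_multiplier_def)
  assume zero: "hcoeff z [] = 0"
  have "TF (right_unshift k (hardy_fst z)) = right_unshift k (TF (hardy_fst z))"
    using z zero by (intro left_multiplier_right_unshift[OF TF F])
      (auto simp: hardy_tensor_Times hcoeff_hardy_fst)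
  moreover have "TG (right_unshift k (hardy_snd z)) = right_unshift k (TG (hardy_snd z))"
    using z zero by (intro left_multiplier_right_unshift[OF TG G])
      (auto simp: hardy_tensor_Times hcoeff_hardy_snd)
  ultimately show "right_unshift k z \<in> ?K"
    using z by (auto simp: hardy_tensor_Times hardy_fst_right_unshift hardy_snd_right_unshift
        hardy_tensor_right_unshift)
qed

section \<open>The multiplier for the intersection of two ranges\<close>

theorem corollary6p1:
  fixes F :: "'f::chilbert_space set" and G :: "'g::chilbert_space set"
    and J :: "'j::chilbert_space set"
    and TF :: "('d::finite, 'f) hardy \<Rightarrow> ('d, 'j) hardy"
    and TG :: "('d, 'g) hardy \<Rightarrow> ('d, 'j) hardy"
  assumes "closed_csubspace F" and "closed_csubspace G" and "closed_csubspace J"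
    and "left_multiplier F J TF" and "left_multiplier G J TG"
  shows "\<exists>(H :: ('d, 'f \<times> 'g) hardy set)
            (TH :: ('d, ('d, 'f \<times> 'g) hardy) hardy \<Rightarrow> ('d, 'j) hardy).
           closed_csubspace H \<and> left_multiplier H J TH \<and>
           hilbert_dim H \<le>o hilbert_dim F +c hilbert_dim G \<and>
           wedge (mult_range F TF) (mult_range G TG) = mult_range H TH \<and>
           TH ` hardy_tensor H = TF ` hardy_tensor F \<inter> TG ` hardy_tensor G \<and>
           op_norm (hardy_tensor H) TH
             \<le> max (op_norm (hardy_tensor F) TF) (op_norm (hardy_tensor G) TG)"
proof -
  note F = assms(1) and G = assms(2) and TF = assms(4) and TG = assms(5)
  define K where "K = {z \<in> hardy_tensor (F \<times> G). TF (hardy_fst z) = TG (hardy_snd z)}"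
  interpret K: divisible_invariant_subspace K
    unfolding K_def by (rule divisible_invariant_pair_kernel[OF F G TF TG])
  let ?H = "K.wandering"
  \<comment> \<open>On \<open>K\<close> both multipliers give the same value, so \<open>TG\<close>
    of the second component defines the same operator; this is \<open>TH_pair\<close>.\<close>
  define TH where "TH = (\<lambda>f. TF (hardy_fst (K.inner_op f)))"
  let ?F = "hardy_tensor F :: ('d, 'f) hardy set" and ?G = "hardy_tensor G :: ('d, 'g) hardy set"
    and ?S = "hardy_tensor ?H :: ('d, ('d, 'f \<times> 'g) hardy) hardy set"
  have cF: "closed_csubspace ?F" and cG: "closed_csubspace ?G" and cS: "closed_csubspace ?S"
    by (intro closed_csubspace_hardy_tensor F G K.closed_csubspace_wandering)+
  have bF: "bounded_clinear_on ?F TF" and bG: "bounded_clinear_on ?G TG"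
    using TF TG by (auto simp: left_multiplier_def)
  have KD: "hardy_fst z \<in> ?F" "hardy_snd z \<in> ?G" "TF (hardy_fst z) = TG (hardy_snd z)"
    if "z \<in> K" for z
    using that by (auto simp: K_def hardy_tensor_Times)
  have "bounded_clinear_on ?S (\<lambda>f. hardy_fst (K.inner_op f))"
    by (rule bounded_clinear_on_compose[OF K.bounded_clinear_on_inner_op _
          bounded_clinear_on_hardy_fst[of UNIV]]) simp
  then have bH: "bounded_clinear_on ?S TH"
    unfolding TH_def
    by (rule bounded_clinear_on_compose[OF _ _ bF]) (use K.inner_op_mem KD(1) in blast)
  have TH_pair: "TH f = TG (hardy_snd (K.inner_op f))" if "f \<in> ?S" for f
    using KD(3)[OF K.inner_op_mem[OF that]] by (simp add: TH_def)
  \<comment> \<open>A pair with a common image is an element of \<open>K\<close>, hence the image of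
    some \<open>f\<close> of the same norm.\<close>
  have lift: "\<exists>f\<in>?S. TH f = TF x \<and> (norm f)\<^sup>2 = (norm x)\<^sup>2 + (norm y)\<^sup>2"
    if "x \<in> ?F" "y \<in> ?G" "TF x = TG y" for x y
  proof -
    obtain z where z: "hardy_fst z = x" "hardy_snd z = y" by (rule hardy_pair_exists)
    then have "z \<in> K" using that by (simp add: K_def hardy_tensor_Times)
    then obtain f where "f \<in> ?S" "z = K.inner_op f" using K.range_inner_op by blast
    then show ?thesis
      using z K.norm_inner_op norm_hardy_prod[of z] by (auto simp: TH_def)
  qed
  have range: "TH ` ?S = TF ` ?F \<inter> TG ` ?G"
  proof
    show "TH ` ?S \<subseteq> TF ` ?F \<inter> TG ` ?G"
    proof
      fix h assume "h \<in> TH ` ?S"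
      then obtain f where "f \<in> ?S" "h = TH f" by blast
      then show "h \<in> TF ` ?F \<inter> TG ` ?G"
        using KD(1,2)[OF K.inner_op_mem[of f]] TH_pair[of f] unfolding TH_def by blast
    qed
    show "TF ` ?F \<inter> TG ` ?G \<subseteq> TH ` ?S"
    proof
      fix h assume "h \<in> TF ` ?F \<inter> TG ` ?G"
      then obtain x y where "x \<in> ?F" "y \<in> ?G" "h = TF x" "h = TG y" by blast
      then show "h \<in> TH ` ?S" using lift[of x y] by force
    qed
  qed
  have mult: "left_multiplier ?H J TH"
    unfolding left_multiplier_def
  proof (intro conjI allI ballI bH)
    have "TF ` ?F \<subseteq> hardy_tensor J" using TF by (simp add: left_multiplier_def)
    then show "TH ` ?S \<subseteq> hardy_tensor J" unfolding range by blast
    fix k f assume f: "f \<in> ?S"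
    show "TH (right_shift k f) = right_shift k (TH f)"
      using TF KD(1)[OF K.inner_op_mem[OF f]]
      by (simp add: TH_def K.inner_op_right_shift[OF f] hardy_fst_right_shift left_multiplier_def)
  qed
  have dim: "hilbert_dim ?H \<le>o hilbert_dim F +c hilbert_dim G"
  \<comment> \<open>The two maps are the components of the constant term, which is injective on the
    wandering subspace.\<close>
  proof (rule hilbert_dim_le_prod[OF K.closed_csubspace_wandering F G])
    have le: "norm (fst (hcoeff x [])) \<le> 1 * norm x" "norm (snd (hcoeff x [])) \<le> 1 * norm x"
      for x :: "('d, 'f \<times> 'g) hardy"
      using norm_fst_le_norm[of "hcoeff x []"] norm_snd_le_norm[of "hcoeff x []"] norm_hcoeff_le[of x "[]"]
      by linarith+
    show "bounded_clinear_on ?H (\<lambda>x. fst (hcoeff x []))" "bounded_clinear_on ?H (\<lambda>x. snd (hcoeff x []))"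
      unfolding bounded_clinear_on_def using le
      by (auto simp: hcoeff_simps hcoeff_scaleC scaleC_prod_def intro!: exI[of _ 1])
    show "(\<lambda>x. fst (hcoeff x [])) ` ?H \<subseteq> F" "(\<lambda>x. snd (hcoeff x [])) ` ?H \<subseteq> G"
      using K.wandering_subset by (force simp: K_def hardy_tensor_def mem_Times_iff)+
    show "x = 0" if "x \<in> ?H" "fst (hcoeff x []) = 0" "snd (hcoeff x []) = 0" for x
      using that by (intro K.wandering_determined_by_constant_term) (auto simp: prod_eq_iff)
  qed
  have norms: "sqrt ((snd (range_space ?F TF) h)\<^sup>2 + (snd (range_space ?G TG) h)\<^sup>2)
      = snd (range_space ?S TH) h" (is "sqrt (?nF\<^sup>2 + ?nG\<^sup>2) = ?nH") if h: "h \<in> TF ` ?F \<inter> TG ` ?G" for h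
  proof (rule antisym)
    \<comment> \<open>Shortest preimages under \<open>TF\<close> and \<open>TG\<close> lift to one
      preimage under \<open>TH\<close>, which bounds \<open>?nH\<close> from above.\<close>
    obtain x where x: "x \<in> ?F" "TF x = h" "norm x = ?nF"
      using range_space_norm_attained[OF cF bF] h by blast
    obtain y where y: "y \<in> ?G" "TG y = h" "norm y = ?nG"
      using range_space_norm_attained[OF cG bG] h by blast
    obtain f where f: "f \<in> ?S" "TH f = h" "(norm f)\<^sup>2 = ?nF\<^sup>2 + ?nG\<^sup>2"
      using lift[OF x(1) y(1)] x y by auto
    have "?nH \<le> norm f" using range_space_norm_le[OF cS bH f(1)] f(2) by simp
    also have "norm f = sqrt (?nF\<^sup>2 + ?nG\<^sup>2)" by (simp flip: f(3))
    finally show "?nH \<le> sqrt (?nF\<^sup>2 + ?nG\<^sup>2)" .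
    \<comment> \<open>Conversely, a shortest preimage under \<open>TH\<close> splits into preimages
      under \<open>TF\<close> and \<open>TG\<close>.\<close>
    obtain g where g: "g \<in> ?S" "TH g = h" "norm g = ?nH"
      using range_space_norm_attained[OF cS bH] h unfolding range by blast
    define z where "z = K.inner_op g"
    have z: "z \<in> K" "norm z = ?nH"
      unfolding z_def using K.inner_op_mem[OF g(1)] K.norm_inner_op[OF g(1)] g(3) by auto
    have "?nF \<le> norm (hardy_fst z)" "?nG \<le> norm (hardy_snd z)"
      using range_space_norm_le[OF cF bF KD(1)[OF z(1)]] range_space_norm_le[OF cG bG KD(2)[OF z(1)]]
        g(2) KD(3)[OF z(1)] by (auto simp: TH_def z_def)
    moreover have "0 \<le> ?nF" "0 \<le> ?nG" by (simp_all flip: x(3) y(3))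
    ultimately have "?nF\<^sup>2 + ?nG\<^sup>2 \<le> (norm z)\<^sup>2"
      unfolding norm_hardy_prod[of z] by (intro add_mono power_mono)
    then have "sqrt (?nF\<^sup>2 + ?nG\<^sup>2) \<le> norm z" by (intro real_le_lsqrt) auto
    then show "sqrt (?nF\<^sup>2 + ?nG\<^sup>2) \<le> ?nH" by (simp only: z(2))
  qed
  have wedge: "wedge (mult_range F TF) (mult_range G TG) = mult_range ?H TH"
  proof (rule prod_eqI)
    show "fst (wedge (mult_range F TF) (mult_range G TG)) = fst (mult_range ?H TH)"
      by (simp add: wedge_def mult_range_def range_space_def range)
    show "snd (wedge (mult_range F TF) (mult_range G TG)) = snd (mult_range ?H TH)"
    proof
      fix h
      have fst: "fst (range_space ?F TF) = TF ` ?F" "fst (range_space ?G TG) = TG ` ?G"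
        by (simp_all add: range_space_def)
      \<comment> \<open>Equality of the norm functions also concerns vectors outside the range,
        where both are \<open>undefined\<close>.\<close>
      have "snd (range_space ?S TH) h = undefined" if "h \<notin> TF ` ?F \<inter> TG ` ?G"
        using that unfolding range_space_def range by auto
      then show "snd (wedge (mult_range F TF) (mult_range G TG)) h = snd (mult_range ?H TH) h"
        using norms[of h] by (cases "h \<in> TF ` ?F \<inter> TG ` ?G")
          (simp_all add: wedge_def mult_range_def fst)
    qed
  qed
  \<comment> \<open>\<open>TH\<close> is \<open>TF\<close> after a contraction, so the norm of
    \<open>TF\<close> alone is already a bound.\<close>
  have "op_norm ?S TH \<le> op_norm ?F TF"
    unfolding op_norm_def[of ?S]
  proof (rule cSUP_least)
    show "{f \<in> ?S. norm f \<le> 1} \<noteq> {}" using closed_csubspaceD(2)[OF cS] by force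
    fix f assume "f \<in> {f \<in> ?S. norm f \<le> 1}"
    then have f: "f \<in> ?S" "norm f \<le> 1" by auto
    have "norm (hardy_fst (K.inner_op f)) \<le> 1"
      using norm_hardy_fst_le[of "K.inner_op f"] K.norm_inner_op[OF f(1)] f(2) by simp
    then show "norm (TH f) \<le> op_norm ?F TF"
      unfolding TH_def by (intro op_norm_upper[OF bF] KD(1)[OF K.inner_op_mem[OF f(1)]])
  qed
  then have "op_norm ?S TH \<le> max (op_norm ?F TF) (op_norm ?G TG)" by simp
  with K.closed_csubspace_wandering mult dim wedge range show ?thesis by blast
qed

end
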